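(* In the setting described in the context, with $X$ discrete taking the values $v_1,\dots,v_b$, let $$\hat q_j=\sum_{k=1}^b\hat p_k\,\hat d_{jk},\qquad \hat p_k=\frac{M_k+N_k}{n},\qquad \hat d_{jk}=\frac{T_{jk}}{M_k}.$$ Then $\hat q_j$ is asymptotically equivalent to $\sum_{k=1}^b d_{jk}\,\hat p_k$, whose variance is $$\frac1n\left(\sum_{k=1}^b d_{jk}^2\,p_k(1-p_k)-2\sum_{k=1}^b\sum_{s=k+1}^b d_{jk}d_{js}\,p_kp_s\right).$$ Without the unlabeled data, this expression would be the same but with a factor of $1/r$ instead of $1/n$. Hence use of the unlabeled data gives smaller asymptotic variance: $\hat q_j$ is superior in this sense to the estimator $\bar Y^{(j)}=\frac1r\sum_{i=1}^rY_i^{(j)}$ based only on the labeled data (which is what $\hat q_j$ reduces to if unlabeled data are not used).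
   Context: The data are a random sample $(X_i,Y_i)$, $i=1,\dots,n$, from the distribution of $(X,Y)$, where $X$ is a feature vector and $Y=(Y^{(1)},\dots,Y^{(c)})^T$ is the class identification vector: $Y^{(j)}$ is 1 or 0 according to whether the item belongs to class $j$. $Y_i^{(j)}$ is component $j$ of $Y_i$. All the $X_i$ are observed; $Y_i$ is known for $i=1,\dots,r$ (labeled observations) but unknown for $i=r+1,\dots,n$ (unlabeled observations), and some observations are unlabeled, i.e. $r<n$. It is assumed that $r/n$ tends to a limit $\gamma$ as $n\to\infty$. $X$ is discrete, taking on $b$ vector values $v_1,\dots,v_b$, and the labeled data are assumed extensive enough that for each $k$ there is some labeled $i$ with $X_i=v_k$. For a class $j$, set $p_k=P(X=v_k)$ and $d_{jk}=P(Y^{(j)}=1\mid X=v_k)$, so that the prior probability of class $j$ is $q_j=E[Y^{(j)}]=\sum_{k=1}^b p_kd_{jk}$; this is the quantity being estimated. With $1_{ik}$ the indicator of $X_i=v_k$, the counts are $M_k=\sum_{i=1}^r1_{ik}$ (labeled observations with value $v_k$), $N_k=\sum_{i=r+1}^n1_{ik}$ (unlabeled observations with value $v_k$), and $T_{jk}=\sum_{i=1}^r1_{ik}Y_i^{(j)}$ (class-$j$ labeled observations with value $v_k$).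
   Formalization: Asymptotic equivalence means the difference tends to 0 in probability (the √n version is false); r→∞ is assumed; "smaller" is strict only if the d_jk are not all equal and, for limiting variances of √r-scaled errors, also γ<1; otherwise it is ≤. *)

theory Defs
  imports "HOL-Probability.Probability"
begin

text \<open>
  Indices follow the usual one-based convention: observations \<open>1, 2, \<dots>\<close> (the first \<open>r\<close> of the
  first \<open>n\<close> are labeled), and values \<open>v 1, \<dots>, v b\<close> of the feature vector.  Class labels are
  the indices of the finite type \<open>'c\<close>.
\<close>

section \<open>Population quantities\<close>

definition val_prob :: "'w measure \<Rightarrow> ('w \<Rightarrow> 'x) \<Rightarrow> (nat \<Rightarrow> 'x) \<Rightarrow> nat \<Rightarrow> real" where
  "val_prob M X v k = \<P>(\<omega> in M. X \<omega> = v k)"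

definition class_prob ::
    "'w measure \<Rightarrow> ('w \<Rightarrow> 'x) \<Rightarrow> ('w \<Rightarrow> real ^ 'c) \<Rightarrow> (nat \<Rightarrow> 'x) \<Rightarrow> 'c \<Rightarrow> nat \<Rightarrow> real" where
  "class_prob M X Y v j k = \<P>(\<omega> in M. Y \<omega> $ j = 1 \<bar> X \<omega> = v k)"

section \<open>Counts and estimators\<close>

definition labeled_count :: "(nat \<Rightarrow> 'w \<Rightarrow> 'x) \<Rightarrow> (nat \<Rightarrow> 'x) \<Rightarrow> nat \<Rightarrow> nat \<Rightarrow> 'w \<Rightarrow> real" where
  "labeled_count Xs v r k \<omega> = (\<Sum>i=1..r. of_bool (Xs i \<omega> = v k))"

definition unlabeled_count ::
    "(nat \<Rightarrow> 'w \<Rightarrow> 'x) \<Rightarrow> (nat \<Rightarrow> 'x) \<Rightarrow> nat \<Rightarrow> nat \<Rightarrow> nat \<Rightarrow> 'w \<Rightarrow> real" where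
  "unlabeled_count Xs v r n k \<omega> = (\<Sum>i=r+1..n. of_bool (Xs i \<omega> = v k))"

definition class_count ::
    "(nat \<Rightarrow> 'w \<Rightarrow> 'x) \<Rightarrow> (nat \<Rightarrow> 'w \<Rightarrow> real ^ 'c) \<Rightarrow> (nat \<Rightarrow> 'x) \<Rightarrow> nat \<Rightarrow> 'c \<Rightarrow> nat \<Rightarrow> 'w \<Rightarrow> real" where
  "class_count Xs Ys v r j k \<omega> = (\<Sum>i=1..r. of_bool (Xs i \<omega> = v k) * (Ys i \<omega> $ j))"

definition p_hat ::
    "(nat \<Rightarrow> 'w \<Rightarrow> 'x) \<Rightarrow> (nat \<Rightarrow> 'x) \<Rightarrow> nat \<Rightarrow> nat \<Rightarrow> nat \<Rightarrow> 'w \<Rightarrow> real" where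
  "p_hat Xs v r n k \<omega> = (labeled_count Xs v r k \<omega> + unlabeled_count Xs v r n k \<omega>) / real n"

text \<open>Where no labeled observation has value \<open>v k\<close>, this is \<open>0\<close> (division by zero).\<close>

definition d_hat ::
    "(nat \<Rightarrow> 'w \<Rightarrow> 'x) \<Rightarrow> (nat \<Rightarrow> 'w \<Rightarrow> real ^ 'c) \<Rightarrow> (nat \<Rightarrow> 'x) \<Rightarrow> nat \<Rightarrow> 'c \<Rightarrow> nat \<Rightarrow> 'w \<Rightarrow> real" where
  "d_hat Xs Ys v r j k \<omega> = class_count Xs Ys v r j k \<omega> / labeled_count Xs v r k \<omega>"

text \<open>
  Not using the unlabeled data means taking \<open>n = r\<close> in the following definition: all unlabeled
  counts are then \<open>0\<close> and \<open>p_hat\<close> is the labeled count divided by \<open>r\<close>.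
\<close>

definition q_hat ::
    "(nat \<Rightarrow> 'w \<Rightarrow> 'x) \<Rightarrow> (nat \<Rightarrow> 'w \<Rightarrow> real ^ 'c) \<Rightarrow> (nat \<Rightarrow> 'x) \<Rightarrow> nat \<Rightarrow> 'c \<Rightarrow>
      nat \<Rightarrow> nat \<Rightarrow> 'w \<Rightarrow> real" where
  "q_hat Xs Ys v b j r n \<omega> = (\<Sum>k=1..b. p_hat Xs v r n k \<omega> * d_hat Xs Ys v r j k \<omega>)"

definition Y_bar :: "(nat \<Rightarrow> 'w \<Rightarrow> real ^ 'c) \<Rightarrow> 'c \<Rightarrow> nat \<Rightarrow> 'w \<Rightarrow> real" where
  "Y_bar Ys j r \<omega> = (\<Sum>i=1..r. Ys i \<omega> $ j) / real r"

section \<open>Asymptotic notions\<close>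

text \<open>Asymptotic equivalence of statistics: the difference tends to \<open>0\<close> in probability.\<close>

definition asymp_equivalent ::
    "'w measure \<Rightarrow> (nat \<Rightarrow> 'w \<Rightarrow> real) \<Rightarrow> (nat \<Rightarrow> 'w \<Rightarrow> real) \<Rightarrow> bool" where
  "asymp_equivalent M A B \<longleftrightarrow>
     (\<forall>\<epsilon>>0. (\<lambda>n. \<P>(\<omega> in M. \<epsilon> \<le> \<bar>A n \<omega> - B n \<omega>\<bar>)) \<longlonglongrightarrow> 0)"

text \<open>
  The estimators \<open>S n\<close> of \<open>\<theta>\<close> have asymptotic variance \<open>\<tau> / a n\<close>: the normalized error
  \<open>sqrt (a n) * (S n - \<theta>)\<close> converges in distribution to the normal law with mean \<open>0\<close> and
  variance \<open>\<tau>\<close>.  That law is written as the image of the standard normal law, so that \<open>\<tau> = 0\<close>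
  gives the point mass at \<open>0\<close>.
\<close>

definition has_asymp_variance ::
    "'w measure \<Rightarrow> (nat \<Rightarrow> 'w \<Rightarrow> real) \<Rightarrow> real \<Rightarrow> (nat \<Rightarrow> real) \<Rightarrow> real \<Rightarrow> bool" where
  "has_asymp_variance M S \<theta> a \<tau> \<longleftrightarrow> 0 \<le> \<tau> \<and>
     weak_conv_m (\<lambda>n. distr M borel (\<lambda>\<omega>. sqrt (a n) * (S n \<omega> - \<theta>)))
       (distr std_normal_distribution borel (\<lambda>z. sqrt \<tau> * z))"

end

theory Submission
  imports Defs
begin

text \<open>
  Write \<open>z\<^sub>i = (X\<^sub>i, Y\<^sub>i)\<close>.  The error of \<open>q_hat\<close> splits into the within-cell noise
  \<open>noise z = (\<Sum>k. 1{x = v\<^sub>k} (y\<^sub>j - d\<^sub>k))\<close>, averaged over the labeled observations, and the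
  between-cell deviation \<open>trend z = (\<Sum>k. d\<^sub>k 1{x = v\<^sub>k}) - q\<close>, averaged over all
  \<open>n\<close> observations.  The two are centered and uncorrelated, so \<open>sqrt r (q_hat - q)\<close> has limit
  variance \<open>E noise\<^sup>2 + \<gamma> E trend\<^sup>2\<close>, whereas for the labeled mean the
  factor \<open>\<gamma>\<close> is replaced by \<open>1\<close>.  The remainder is a sum of products of a factor bounded in
  \<open>L\<^sup>2\<close> and a factor tending to \<open>0\<close> in probability; the limit law of the main part is a central
  limit theorem for arrays with uniformly bounded rows.
\<close>

text \<open>\<open>asymp_equivalent\<close> only asks the difference to tend to 0 in probability, so
  the equivalence follows once both statistics are shown to tend to \<open>q\<close>. At the finer
  scale \<open>sqrt r\<close> they are not equivalent: \<open>q_hat\<close> carries in addition the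
  averaged noise, whose limit variance \<open>noise_var\<close> need not vanish. The comparison of
  limit laws therefore cannot be read off from the variance of the sum of the
  \<open>d k * p_hat\<close>; it needs a limit theorem for \<open>q_hat\<close> itself. The scale is
  \<open>sqrt r\<close> and not \<open>sqrt n\<close> because \<gamma> = 0 is allowed: at scale
  \<open>sqrt n\<close> the noise would have variance about \<open>n / r * noise_var\<close>. An
  array is unavoidable because the weight of a given observation changes with \<open>n\<close>, both
  through the normalization and through its turning from unlabeled into labeled. The noise costs the
  same with and without unlabeled data, so the gain is exactly
  \<open>(1 - \<gamma>) * trend_var\<close>.\<close>

subsection \<open>Convergence in probability\<close>

text \<open>A union bound, phrased for events rather than sizes: a \<open>\<delta>\<close> depending
  on \<open>\<epsilon>\<close> lets it serve for quotients as well as sums. The quantifiers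
  "eventually" and "almost everywhere" absorb the indices with \<open>r n = 0\<close> and the null
  sets. Where one comparison suffices, the other is filled with 0 against 0.\<close>

lemma (in prob_space) asymp_equivalent_dominated:
  assumes dom: "\<And>\<epsilon>. 0 < \<epsilon> \<Longrightarrow> \<exists>\<delta>>0. \<forall>\<^sub>F n in sequentially. AE \<omega> in M.
      \<epsilon> \<le> \<bar>A n \<omega> - B n \<omega>\<bar> \<longrightarrow> \<delta> \<le> \<bar>C n \<omega> - D n \<omega>\<bar> \<or> \<delta> \<le> \<bar>E n \<omega> - F n \<omega>\<bar>"
    and CD: "asymp_equivalent M C D" and EF: "asymp_equivalent M E F"
    and [measurable]: "\<And>n. C n \<in> borel_measurable M" "\<And>n. D n \<in> borel_measurable M"
      "\<And>n. E n \<in> borel_measurable M" "\<And>n. F n \<in> borel_measurable M"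
  shows "asymp_equivalent M A B"
  unfolding asymp_equivalent_def
proof (intro allI impI)
  fix \<epsilon> :: real assume "0 < \<epsilon>"
  then obtain \<delta> where "0 < \<delta>" and ev: "\<forall>\<^sub>F n in sequentially. AE \<omega> in M.
      \<epsilon> \<le> \<bar>A n \<omega> - B n \<omega>\<bar> \<longrightarrow> \<delta> \<le> \<bar>C n \<omega> - D n \<omega>\<bar> \<or> \<delta> \<le> \<bar>E n \<omega> - F n \<omega>\<bar>"
    using dom by blast
  let ?C = "\<lambda>n. {\<omega> \<in> space M. \<delta> \<le> \<bar>C n \<omega> - D n \<omega>\<bar>}"
  let ?E = "\<lambda>n. {\<omega> \<in> space M. \<delta> \<le> \<bar>E n \<omega> - F n \<omega>\<bar>}"
  have "\<forall>\<^sub>F n in sequentially. norm (\<P>(\<omega> in M. \<epsilon> \<le> \<bar>A n \<omega> - B n \<omega>\<bar>)) \<le> prob (?C n) + prob (?E n)"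
    using ev
  proof eventually_elim
    case (elim n)
    have "\<P>(\<omega> in M. \<epsilon> \<le> \<bar>A n \<omega> - B n \<omega>\<bar>) \<le> prob (?C n \<union> ?E n)"
      using elim by (intro finite_measure_mono_AE) auto
    also have "\<dots> \<le> prob (?C n) + prob (?E n)"
      by (intro measure_Un_le) auto
    finally show ?case by simp
  qed
  moreover have "(\<lambda>n. prob (?C n) + prob (?E n)) \<longlonglongrightarrow> 0"
    using CD EF \<open>0 < \<delta>\<close> unfolding asymp_equivalent_def by (intro tendsto_add_zero) auto
  ultimately show "(\<lambda>n. \<P>(\<omega> in M. \<epsilon> \<le> \<bar>A n \<omega> - B n \<omega>\<bar>)) \<longlonglongrightarrow> 0"
    by (rule Lim_null_comparison)
qed

lemma (in prob_space) asymp_equivalent_add: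
  assumes AB: "asymp_equivalent M A B" and CD: "asymp_equivalent M C D"
    and [measurable]: "\<And>n. A n \<in> borel_measurable M" "\<And>n. B n \<in> borel_measurable M"
      "\<And>n. C n \<in> borel_measurable M" "\<And>n. D n \<in> borel_measurable M"
  shows "asymp_equivalent M (\<lambda>n \<omega>. A n \<omega> + C n \<omega>) (\<lambda>n \<omega>. B n \<omega> + D n \<omega>)"
proof (rule asymp_equivalent_dominated[OF _ AB CD])
  fix \<epsilon> :: real assume "0 < \<epsilon>"
  have "\<bar>x + z - (y + w)\<bar> < \<epsilon>" if "\<bar>x - y\<bar> < \<epsilon> / 2" "\<bar>z - w\<bar> < \<epsilon> / 2" for x y z w
    using abs_diff_triangle_ineq[of x z y w] that by linarith
  with \<open>0 < \<epsilon>\<close> show "\<exists>\<delta>>0. \<forall>\<^sub>F n in sequentially. AE \<omega> in M. \<epsilon> \<le> \<bar>A n \<omega> + C n \<omega> - (B n \<omega> + D n \<omega>)\<bar> \<longrightarrow>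
      \<delta> \<le> \<bar>A n \<omega> - B n \<omega>\<bar> \<or> \<delta> \<le> \<bar>C n \<omega> - D n \<omega>\<bar>"
    by (intro exI[of _ "\<epsilon> / 2"] conjI always_eventually allI AE_I2) (auto simp flip: not_less)
qed simp_all

lemma (in prob_space) asymp_equivalent_common_limit:
  assumes AC: "asymp_equivalent M A C" and BC: "asymp_equivalent M B C"
    and [measurable]: "\<And>n. A n \<in> borel_measurable M" "\<And>n. B n \<in> borel_measurable M"
      "\<And>n. C n \<in> borel_measurable M"
  shows "asymp_equivalent M A B"
proof (rule asymp_equivalent_dominated[OF _ AC BC])
  fix \<epsilon> :: real assume "0 < \<epsilon>"
  have "\<bar>x - y\<bar> < \<epsilon>" if "\<bar>x - z\<bar> < \<epsilon> / 2" "\<bar>y - z\<bar> < \<epsilon> / 2" for x y z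
    using that by linarith
  with \<open>0 < \<epsilon>\<close> show "\<exists>\<delta>>0. \<forall>\<^sub>F n in sequentially. AE \<omega> in M. \<epsilon> \<le> \<bar>A n \<omega> - B n \<omega>\<bar> \<longrightarrow>
      \<delta> \<le> \<bar>A n \<omega> - C n \<omega>\<bar> \<or> \<delta> \<le> \<bar>B n \<omega> - C n \<omega>\<bar>"
    by (intro exI[of _ "\<epsilon> / 2"] conjI always_eventually allI AE_I2) (auto simp flip: not_less)
qed simp_all

lemma asymp_equivalent_refl: "asymp_equivalent M A A"
  unfolding asymp_equivalent_def by simp

lemma (in prob_space) asymp_equivalent_sum:
  assumes "\<And>k. k \<in> I \<Longrightarrow> asymp_equivalent M (A k) (B k)"
    and [measurable]: "\<And>k n. A k n \<in> borel_measurable M" "\<And>k n. B k n \<in> borel_measurable M"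
  shows "asymp_equivalent M (\<lambda>n \<omega>. \<Sum>k\<in>I. A k n \<omega>) (\<lambda>n \<omega>. \<Sum>k\<in>I. B k n \<omega>)"
  using assms(1)
  by (induction I rule: infinite_finite_induct)
    (simp_all add: asymp_equivalent_refl asymp_equivalent_add)

text \<open>Chebyshev's inequality for each fixed \<open>\<epsilon>\<close>.\<close>

lemma (in prob_space) asymp_equivalent_second_moment:
  assumes [measurable]: "\<And>n. A n \<in> borel_measurable M" "\<And>n. B n \<in> borel_measurable M"
    and int: "\<And>n. integrable M (\<lambda>\<omega>. (A n \<omega> - B n \<omega>)\<^sup>2)"
    and lim: "(\<lambda>n. expectation (\<lambda>\<omega>. (A n \<omega> - B n \<omega>)\<^sup>2)) \<longlonglongrightarrow> 0"
  shows "asymp_equivalent M A B"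
  unfolding asymp_equivalent_def
proof (intro allI impI)
  fix \<epsilon> :: real assume "0 < \<epsilon>"
  have "norm (\<P>(\<omega> in M. \<epsilon> \<le> \<bar>A n \<omega> - B n \<omega>\<bar>)) \<le> expectation (\<lambda>\<omega>. (A n \<omega> - B n \<omega>)\<^sup>2) / \<epsilon>\<^sup>2" for n
    using second_moment_method[of "\<lambda>\<omega>. A n \<omega> - B n \<omega>" \<epsilon>] int \<open>0 < \<epsilon>\<close> by simp
  moreover have "(\<lambda>n. expectation (\<lambda>\<omega>. (A n \<omega> - B n \<omega>)\<^sup>2) / \<epsilon>\<^sup>2) \<longlonglongrightarrow> 0"
    using lim by (rule tendsto_divide_zero)
  ultimately show "(\<lambda>n. \<P>(\<omega> in M. \<epsilon> \<le> \<bar>A n \<omega> - B n \<omega>\<bar>)) \<longlonglongrightarrow> 0"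
    by (rule Lim_null_comparison[OF always_eventually[OF allI]])
qed

lemma (in prob_space) asymp_equivalent_ratio:
  assumes "0 < a" and A: "asymp_equivalent M A (\<lambda>_ _. a)" and B: "asymp_equivalent M B (\<lambda>_ _. a)"
    and [measurable]: "\<And>n. A n \<in> borel_measurable M" "\<And>n. B n \<in> borel_measurable M"
  shows "asymp_equivalent M (\<lambda>n \<omega>. A n \<omega> / B n \<omega>) (\<lambda>_ _. 1)"
proof (rule asymp_equivalent_dominated[OF _ A B])
  fix \<epsilon> :: real assume "0 < \<epsilon>"
  \<comment> \<open>The first entry keeps the denominator above \<open>a / 2\<close>; the second
    keeps numerator and denominator within \<open>\<epsilon> * a / 2\<close> of each other.\<close>
  define \<delta> where "\<delta> = min (a / 2) (\<epsilon> * a / 4)"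
  have "0 < \<delta>" using \<open>0 < \<epsilon>\<close> \<open>0 < a\<close> by (simp add: \<delta>_def)
  have "\<bar>x / y - 1\<bar> < \<epsilon>" if "\<bar>x - a\<bar> < \<delta>" "\<bar>y - a\<bar> < \<delta>" for x y
  proof -
    have y: "y > a / 2" using that unfolding \<delta>_def by linarith
    have "x / y - 1 = (x - y) / y" using y \<open>0 < a\<close> by (simp add: diff_divide_distrib)
    then have "\<bar>x / y - 1\<bar> = \<bar>x - y\<bar> / y" using y \<open>0 < a\<close> by simp
    moreover have "\<bar>x - y\<bar> < \<epsilon> * a / 2" using that unfolding \<delta>_def by linarith
    moreover have "\<epsilon> * a / 2 < \<epsilon> * y" using y \<open>0 < \<epsilon>\<close> by (simp add: field_simps)
    ultimately show ?thesis using y \<open>0 < a\<close> by (simp add: divide_less_eq)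
  qed
  then show "\<exists>\<delta>>0. \<forall>\<^sub>F n in sequentially. AE \<omega> in M. \<epsilon> \<le> \<bar>A n \<omega> / B n \<omega> - 1\<bar> \<longrightarrow>
      \<delta> \<le> \<bar>A n \<omega> - a\<bar> \<or> \<delta> \<le> \<bar>B n \<omega> - a\<bar>"
    using \<open>0 < \<delta>\<close> by (intro exI[of _ \<delta>] conjI always_eventually allI AE_I2) (auto simp flip: not_less)
qed simp_all

text \<open>The second moments make \<open>U\<close> tight: \<open>L \<le> |U n|\<close> has
  probability at most \<open>K / L\<^sup>2\<close>, uniformly in \<open>n\<close>, and elsewhere a
  product of size \<open>\<epsilon>\<close> forces \<open>|W n|\<close> to be at least
  \<open>\<epsilon> / L\<close>. The two factors may be dependent, as \<open>resid_sum\<close> and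
  \<open>weight_error\<close> are.\<close>

lemma (in prob_space) asymp_equivalent_mult_bounded_second_moment:
  assumes W: "asymp_equivalent M W (\<lambda>_ _. 0)"
    and [measurable]: "\<And>n. U n \<in> borel_measurable M" "\<And>n. W n \<in> borel_measurable M"
    and int: "\<And>n. integrable M (\<lambda>\<omega>. (U n \<omega>)\<^sup>2)"
    and bound: "\<And>n. expectation (\<lambda>\<omega>. (U n \<omega>)\<^sup>2) \<le> K"
  shows "asymp_equivalent M (\<lambda>n \<omega>. U n \<omega> * W n \<omega>) (\<lambda>_ _. 0)"
  unfolding asymp_equivalent_def
proof (intro allI impI LIMSEQ_I)
  fix \<epsilon> \<eta> :: real assume "0 < \<epsilon>" "0 < \<eta>"
  \<comment> \<open>The summand 1 in \<open>K + 1\<close> gives a strict inequality; the maximum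
    with 1 gives \<open>L \<le> L\<^sup>2\<close>.\<close>
  define L where "L = max 1 (2 * (K + 1) / \<eta>)"
  have "1 \<le> L" "2 * (K + 1) / \<eta> \<le> L" by (simp_all add: L_def)
  have "0 \<le> K" using order_trans[OF _ bound[of 0]] by simp
  have "K / L\<^sup>2 < \<eta> / 2"
  proof -
    have "2 * K < L * \<eta>" using \<open>2 * (K + 1) / \<eta> \<le> L\<close> \<open>0 < \<eta>\<close> by (simp add: field_simps)
    also have "\<dots> \<le> L\<^sup>2 * \<eta>" using \<open>1 \<le> L\<close> \<open>0 < \<eta>\<close> by (simp add: power2_eq_square)
    finally show ?thesis using \<open>1 \<le> L\<close> by (simp add: field_simps)
  qed
  have "(\<lambda>n. \<P>(\<omega> in M. \<epsilon> / L \<le> \<bar>W n \<omega> - 0\<bar>)) \<longlonglongrightarrow> 0"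
    using W \<open>0 < \<epsilon>\<close> \<open>1 \<le> L\<close> unfolding asymp_equivalent_def by simp
  then have "\<exists>N. \<forall>n\<ge>N. \<P>(\<omega> in M. \<epsilon> / L \<le> \<bar>W n \<omega>\<bar>) < \<eta> / 2"
    using \<open>0 < \<eta>\<close> order_tendstoD(2)[of _ 0 sequentially "\<eta> / 2"] by (simp add: eventually_sequentially)
  then obtain N where N: "\<And>n. N \<le> n \<Longrightarrow> \<P>(\<omega> in M. \<epsilon> / L \<le> \<bar>W n \<omega>\<bar>) < \<eta> / 2"
    by blast
  have "norm (\<P>(\<omega> in M. \<epsilon> \<le> \<bar>U n \<omega> * W n \<omega> - 0\<bar>) - 0) < \<eta>" if "N \<le> n" for n
  proof -
    let ?U = "{\<omega> \<in> space M. L \<le> \<bar>U n \<omega>\<bar>}" and ?W = "{\<omega> \<in> space M. \<epsilon> / L \<le> \<bar>W n \<omega>\<bar>}"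
    have "\<P>(\<omega> in M. \<epsilon> \<le> \<bar>U n \<omega> * W n \<omega> - 0\<bar>) \<le> prob (?U \<union> ?W)"
    proof (intro finite_measure_mono subsetI)
      fix \<omega> assume *: "\<omega> \<in> {\<omega> \<in> space M. \<epsilon> \<le> \<bar>U n \<omega> * W n \<omega> - 0\<bar>}"
      show "\<omega> \<in> ?U \<union> ?W"
      proof (rule ccontr)
        assume "\<omega> \<notin> ?U \<union> ?W"
        then have "\<bar>U n \<omega>\<bar> * \<bar>W n \<omega>\<bar> < L * (\<epsilon> / L)"
          using * \<open>1 \<le> L\<close> by (intro mult_strict_mono) auto
        then show False using * \<open>1 \<le> L\<close> by (simp add: abs_mult)
      qed
    qed measurable
    also have "\<dots> \<le> prob ?U + prob ?W"
      by (intro measure_Un_le) auto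
    also have "prob ?U \<le> expectation (\<lambda>\<omega>. (U n \<omega>)\<^sup>2) / L\<^sup>2"
      using \<open>1 \<le> L\<close> int by (intro second_moment_method) auto
    also have "\<dots> \<le> K / L\<^sup>2" using bound by (intro divide_right_mono) auto
    finally have "\<P>(\<omega> in M. \<epsilon> \<le> \<bar>U n \<omega> * W n \<omega> - 0\<bar>) < \<eta>"
      using N[OF that] \<open>K / L\<^sup>2 < \<eta> / 2\<close> by linarith
    then show ?thesis by simp
  qed
  then show "\<exists>N. \<forall>n\<ge>N. norm (\<P>(\<omega> in M. \<epsilon> \<le> \<bar>U n \<omega> * W n \<omega> - 0\<bar>) - 0) < \<eta>" by blast
qed

subsection \<open>Weak convergence\<close>

text \<open>Factoring out the unimodular \<open>iexp y\<close> leaves the zeroth-order Taylor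
  estimate of \<open>iexp\<close> at 0.\<close>

lemma cmod_iexp_diff_le: "cmod (iexp x - iexp y) \<le> \<bar>x - y\<bar>"
proof -
  have "iexp x - iexp y = iexp y * (iexp (x - y) - 1)"
    by (simp add: right_diff_distrib exp_diff)
  then show ?thesis
    using iexp_approx1[of "x - y" 0] by (simp add: norm_mult)
qed

text \<open>Where \<open>A\<close> and \<open>B\<close> are within \<open>\<epsilon>\<close>, the
  Lipschitz bound for \<open>iexp\<close> applies; on the remaining event the difference of two
  unimodular numbers is at most 2.\<close>

lemma (in prob_space) char_diff_le:
  assumes [measurable]: "A \<in> borel_measurable M" "B \<in> borel_measurable M" and "0 \<le> \<epsilon>"
  shows "cmod (char (distr M borel A) t - char (distr M borel B) t)
    \<le> \<bar>t\<bar> * \<epsilon> + 2 * \<P>(\<omega> in M. \<epsilon> \<le> \<bar>A \<omega> - B \<omega>\<bar>)"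
proof -
  let ?E = "{\<omega> \<in> space M. \<epsilon> \<le> \<bar>A \<omega> - B \<omega>\<bar>}"
  have int: "integrable M (\<lambda>\<omega>. iexp (t * f \<omega>))" if [measurable]: "f \<in> borel_measurable M" for f :: "'a \<Rightarrow> real"
    by (intro integrable_const_bound[where B=1]) auto
  have "char (distr M borel A) t - char (distr M borel B) t
      = (CLINT \<omega>|M. iexp (t * A \<omega>) - iexp (t * B \<omega>))"
    by (simp add: char_def integral_distr int del: of_real_mult)
  also have "cmod \<dots> \<le> expectation (\<lambda>\<omega>. cmod (iexp (t * A \<omega>) - iexp (t * B \<omega>)))"
    by (rule integral_norm_bound)
  also have "\<dots> \<le> expectation (\<lambda>\<omega>. \<bar>t\<bar> * \<epsilon> + 2 * indicator ?E \<omega>)"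
  proof (rule integral_mono)
    fix \<omega> assume "\<omega> \<in> space M"
    have "cmod (iexp (t * A \<omega>) - iexp (t * B \<omega>)) \<le> 1 + 1"
      by (rule order_trans[OF norm_triangle_ineq4]) (simp del: of_real_mult)
    moreover have "cmod (iexp (t * A \<omega>) - iexp (t * B \<omega>)) \<le> \<bar>t\<bar> * \<bar>A \<omega> - B \<omega>\<bar>"
      using cmod_iexp_diff_le[of "t * A \<omega>" "t * B \<omega>"]
      by (simp add: abs_mult right_diff_distrib[symmetric] del: of_real_mult)
    moreover have "0 \<le> \<bar>t\<bar> * \<epsilon>" using \<open>0 \<le> \<epsilon>\<close> by simp
    moreover have "\<bar>t\<bar> * \<bar>A \<omega> - B \<omega>\<bar> \<le> \<bar>t\<bar> * \<epsilon>" if "\<not> \<epsilon> \<le> \<bar>A \<omega> - B \<omega>\<bar>"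
      using that by (intro mult_left_mono) auto
    ultimately show "cmod (iexp (t * A \<omega>) - iexp (t * B \<omega>)) \<le> \<bar>t\<bar> * \<epsilon> + 2 * indicator ?E \<omega>"
      using \<open>\<omega> \<in> space M\<close> by (auto simp: indicator_def)
  qed (auto intro!: int integrable_const_bound[where B="\<bar>t\<bar> * \<epsilon> + 2"]
        integrable_norm Bochner_Integration.integrable_diff simp: indicator_def \<open>0 \<le> \<epsilon>\<close>)
  also have "\<dots> = \<bar>t\<bar> * \<epsilon> + 2 * prob ?E"
    by (subst Bochner_Integration.integral_add)
      (auto intro!: integrable_const_bound[where B=1] simp: indicator_def prob_space simp flip: indicator_def)
  finally show ?thesis .
qed

text \<open>Slutsky's theorem.\<close>

lemma (in prob_space) weak_conv_asymp_equivalent: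
  assumes AB: "asymp_equivalent M A B"
    and [measurable]: "\<And>n. A n \<in> borel_measurable M" "\<And>n. B n \<in> borel_measurable M"
    and B: "weak_conv_m (\<lambda>n. distr M borel (B n)) N" and N: "real_distribution N"
  shows "weak_conv_m (\<lambda>n. distr M borel (A n)) N"
proof (rule levy_continuity)
  fix t
  have "(\<lambda>n. char (distr M borel (B n)) t) \<longlonglongrightarrow> char N t"
    by (rule levy_continuity1[OF _ N B]) (auto intro!: real_distribution_distr)
  moreover have "(\<lambda>n. char (distr M borel (A n)) t - char (distr M borel (B n)) t) \<longlonglongrightarrow> 0"
  proof (rule LIMSEQ_I)
    fix e :: real assume "0 < e"
    \<comment> \<open>The \<open>+ 1\<close> covers \<open>t = 0\<close> and makes the bound
      \<open>e / 2\<close> strict; the other half comes from a probability below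
      \<open>e / 4\<close>, which is counted twice.\<close>
    define \<epsilon> where "\<epsilon> = e / (2 * (\<bar>t\<bar> + 1))"
    have "0 < \<epsilon>" using \<open>0 < e\<close> by (simp add: \<epsilon>_def)
    have "\<bar>t\<bar> * \<epsilon> < e / 2" using \<open>0 < e\<close> by (simp add: \<epsilon>_def field_simps)
    have "(\<lambda>n. \<P>(\<omega> in M. \<epsilon> \<le> \<bar>A n \<omega> - B n \<omega>\<bar>)) \<longlonglongrightarrow> 0"
      using AB \<open>0 < \<epsilon>\<close> unfolding asymp_equivalent_def by simp
    then have "\<exists>m. \<forall>n\<ge>m. \<P>(\<omega> in M. \<epsilon> \<le> \<bar>A n \<omega> - B n \<omega>\<bar>) < e / 4"
      using \<open>0 < e\<close> order_tendstoD(2)[of _ 0 sequentially "e / 4"] by (simp add: eventually_sequentially)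
    then obtain m where m: "\<And>n. m \<le> n \<Longrightarrow> \<P>(\<omega> in M. \<epsilon> \<le> \<bar>A n \<omega> - B n \<omega>\<bar>) < e / 4"
      by blast
    have "norm (char (distr M borel (A n)) t - char (distr M borel (B n)) t - 0) < e" if "m \<le> n" for n
      using char_diff_le[of "A n" "B n" \<epsilon> t] m[OF that] \<open>0 < \<epsilon>\<close> \<open>\<bar>t\<bar> * \<epsilon> < e / 2\<close> by simp
    then show "\<exists>m. \<forall>n\<ge>m. norm (char (distr M borel (A n)) t - char (distr M borel (B n)) t - 0) < e"
      by blast
  qed
  ultimately show "(\<lambda>n. char (distr M borel (A n)) t) \<longlonglongrightarrow> char N t"
    using tendsto_add by fastforce
qed (auto intro!: real_distribution_distr N)

lemma real_distribution_scaled_std_normal: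
  "real_distribution (distr std_normal_distribution borel (\<lambda>z. c * z))"
proof -
  interpret real_distribution std_normal_distribution by (rule real_dist_normal_dist)
  show ?thesis by (rule real_distribution_distr) simp
qed

text \<open>For \<open>c = 0\<close> the law is the point mass at 0 and both sides are 1.\<close>

lemma char_scaled_std_normal:
  "char (distr std_normal_distribution borel (\<lambda>z. c * z)) t = complex_of_real (exp (- ((t * c)\<^sup>2 / 2)))"
proof -
  have "char (distr std_normal_distribution borel (\<lambda>z. c * z)) t = char std_normal_distribution (t * c)"
    by (simp add: char_def integral_distr mult_ac)
  then show ?thesis by (simp add: char_std_normal_distribution)
qed

text \<open>Lindeberg's condition is automatic here because the bounds \<open>B n\<close> tend to \<open>0\<close>.\<close>

lemma (in prob_space) weak_conv_bounded_array:
  fixes \<xi> :: "nat \<Rightarrow> 'i \<Rightarrow> 'a \<Rightarrow> real"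
  assumes indep: "\<And>n. indep_vars (\<lambda>_. borel) (\<xi> n) (I n)"
    and mean: "\<And>n i. i \<in> I n \<Longrightarrow> expectation (\<xi> n i) = 0"
    and bound: "\<And>n i. i \<in> I n \<Longrightarrow> AE \<omega> in M. \<bar>\<xi> n i \<omega>\<bar> \<le> B n"
    and B: "B \<longlonglongrightarrow> 0"
    and var: "(\<lambda>n. \<Sum>i\<in>I n. expectation (\<lambda>\<omega>. (\<xi> n i \<omega>)\<^sup>2)) \<longlonglongrightarrow> \<tau>" and "0 \<le> \<tau>"
  shows "weak_conv_m (\<lambda>n. distr M borel (\<lambda>\<omega>. \<Sum>i\<in>I n. \<xi> n i \<omega>))
    (distr std_normal_distribution borel (\<lambda>z. sqrt \<tau> * z))"
proof (rule levy_continuity)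
  have rv: "\<xi> n i \<in> borel_measurable M" if "i \<in> I n" for n i
    using indep that unfolding indep_vars_def2 by auto
  show "real_distribution (distr M borel (\<lambda>\<omega>. \<Sum>i\<in>I n. \<xi> n i \<omega>))" for n
    by (intro real_distribution_distr borel_measurable_sum rv)
  fix t
  define s where "s n i = expectation (\<lambda>\<omega>. (\<xi> n i \<omega>)\<^sup>2)" for n i
  define V where "V n = (\<Sum>i\<in>I n. s n i)" for n
  define \<phi> where "\<phi> n i = char (distr M borel (\<xi> n i)) t" for n i
  define \<psi> where "\<psi> n i = complex_of_real (exp (- (t\<^sup>2 * s n i / 2)))" for n i
  have s_nonneg: "0 \<le> s n i" for n i by (simp add: s_def)
  have V: "V \<longlonglongrightarrow> \<tau>" using var by (simp add: V_def[abs_def] s_def)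

  \<comment> \<open>Both factors are compared with the Taylor polynomial
    \<open>1 - t\<^sup>2 * s n i / 2\<close>. Keeping \<open>s n i\<close> as a factor of the error
    is essential: after summation it becomes the convergent \<open>V n\<close>, multiplied by
    something that tends to 0.\<close>
  have local_bound: "cmod (\<phi> n i - \<psi> n i) \<le> (\<bar>t\<bar> ^ 3 * B n + t ^ 4 * (B n)\<^sup>2) * s n i" if i: "i \<in> I n" for n i
  proof -
    note [measurable] = rv[OF i]
    have "AE \<omega> in M. 0 \<le> B n" using bound[OF i] by eventually_elim auto
    then have "0 \<le> B n" by simp
    have int2: "integrable M (\<lambda>\<omega>. (\<xi> n i \<omega>)\<^sup>2)"
      using bound[OF i] by (intro integrable_const_bound[where B="(B n)\<^sup>2"]) (auto simp: abs_le_square_iff[symmetric])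
    have int1: "integrable M (\<xi> n i)"
      using bound[OF i] by (intro integrable_const_bound[where B="B n"]) auto
    have "cmod (\<phi> n i - (1 - t\<^sup>2 * s n i / 2)) \<le>
        t\<^sup>2 / 6 * expectation (\<lambda>\<omega>. min (6 * (\<xi> n i \<omega>)\<^sup>2) (\<bar>t\<bar> * \<bar>\<xi> n i \<omega>\<bar> ^ 3))"
      unfolding \<phi>_def s_def
      by (rule char_approx3') (use int1 int2 mean[OF i] in auto)
    \<comment> \<open>One power of the summand is given up to \<open>B n\<close>, leaving its
      square.\<close>
    also have "\<dots> \<le> t\<^sup>2 / 6 * expectation (\<lambda>\<omega>. (\<bar>t\<bar> * B n) * (\<xi> n i \<omega>)\<^sup>2)"
    proof (intro mult_left_mono integral_mono_AE)
      show "AE \<omega> in M. min (6 * (\<xi> n i \<omega>)\<^sup>2) (\<bar>t\<bar> * \<bar>\<xi> n i \<omega>\<bar> ^ 3) \<le> (\<bar>t\<bar> * B n) * (\<xi> n i \<omega>)\<^sup>2"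
        using bound[OF i]
      proof eventually_elim
        case (elim \<omega>)
        have "\<bar>t\<bar> * \<bar>\<xi> n i \<omega>\<bar> ^ 3 = (\<bar>t\<bar> * (\<xi> n i \<omega>)\<^sup>2) * \<bar>\<xi> n i \<omega>\<bar>"
          by (simp add: power3_eq_cube power2_eq_square mult_ac flip: abs_mult)
        also have "\<dots> \<le> (\<bar>t\<bar> * (\<xi> n i \<omega>)\<^sup>2) * B n"
          using elim by (intro mult_left_mono) auto
        finally show ?case by (simp add: mult_ac)
      qed
    next
      show "integrable M (\<lambda>\<omega>. min (6 * (\<xi> n i \<omega>)\<^sup>2) (\<bar>t\<bar> * \<bar>\<xi> n i \<omega>\<bar> ^ 3))"
        by (rule Bochner_Integration.integrable_bound[where f="\<lambda>\<omega>. 6 * (\<xi> n i \<omega>)\<^sup>2"]) (auto intro: int2)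
    qed (use int2 in auto)
    also have "\<dots> = \<bar>t\<bar> ^ 3 * B n / 6 * s n i"
      by (simp add: s_def power3_eq_cube power2_eq_square mult_ac flip: abs_mult)
    also have "\<dots> \<le> \<bar>t\<bar> ^ 3 * B n * s n i"
      using \<open>0 \<le> B n\<close> s_nonneg[of n i] by (intro mult_right_mono) auto
    finally have 1: "cmod (\<phi> n i - (1 - t\<^sup>2 * s n i / 2)) \<le> \<bar>t\<bar> ^ 3 * B n * s n i" .

    have s_le: "s n i \<le> (B n)\<^sup>2"
    proof -
      have "s n i \<le> expectation (\<lambda>_. (B n)\<^sup>2)"
        unfolding s_def using bound[OF i] int2
        by (intro integral_mono_AE) (auto simp: abs_le_square_iff[symmetric])
      then show ?thesis by (simp add: prob_space)
    qed
    define x where "x = t\<^sup>2 * s n i / 2"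
    have "0 \<le> x" using s_nonneg[of n i] by (simp add: x_def)
    have "1 - x \<le> exp (- x)" using exp_ge_add_one_self[of "- x"] by simp
    moreover have "exp (- x) \<le> 1 - x + x\<^sup>2"
    proof -
      have "exp (- x) = 1 / exp x" by (simp add: exp_minus field_simps)
      \<comment> \<open>Going through \<open>1 / (1 + x)\<close> makes the upper bound polynomial:
        clearing the denominator leaves \<open>1 \<le> 1 + x ^ 3\<close>.\<close>
      also have "\<dots> \<le> 1 / (1 + x)"
        using \<open>0 \<le> x\<close> exp_ge_add_one_self[of x] by (intro divide_left_mono) auto
      also have "\<dots> \<le> 1 - x + x\<^sup>2"
      proof -
        have "(1 - x + x\<^sup>2) * (1 + x) = 1 + x ^ 3" by (simp add: algebra_simps power2_eq_square power3_eq_cube)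
        then show ?thesis using \<open>0 \<le> x\<close> by (simp add: divide_le_eq)
      qed
      finally show ?thesis .
    qed
    ultimately have "\<bar>exp (- x) - (1 - x)\<bar> \<le> x\<^sup>2" by simp
    also have "x\<^sup>2 = t ^ 4 * (s n i)\<^sup>2 / 4" by (simp add: x_def power_divide power_mult_distrib flip: power_mult)
    also have "\<dots> \<le> t ^ 4 * ((B n)\<^sup>2 * s n i)"
    proof -
      have "(s n i)\<^sup>2 \<le> (B n)\<^sup>2 * s n i"
        using s_le s_nonneg[of n i] by (simp add: power2_eq_square mult_right_mono)
      then have "t ^ 4 * (s n i)\<^sup>2 \<le> t ^ 4 * ((B n)\<^sup>2 * s n i)" by (intro mult_left_mono) auto
      moreover have "0 \<le> t ^ 4 * (s n i)\<^sup>2" by simp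
      ultimately show ?thesis by linarith
    qed
    finally have 2: "\<bar>exp (- x) - (1 - x)\<bar> \<le> t ^ 4 * (B n)\<^sup>2 * s n i" by (simp add: mult_ac)
    have "cmod ((1 - t\<^sup>2 * s n i / 2) - \<psi> n i) = cmod (complex_of_real ((1 - x) - exp (- x)))"
      by (simp add: \<psi>_def x_def)
    also have "\<dots> = \<bar>exp (- x) - (1 - x)\<bar>" by (simp only: norm_of_real abs_minus_commute)
    finally have 3: "cmod ((1 - t\<^sup>2 * s n i / 2) - \<psi> n i) \<le> t ^ 4 * (B n)\<^sup>2 * s n i" using 2 by simp
    show ?thesis
      using norm_triangle_le[OF add_mono[OF 1 3]] by (simp add: algebra_simps)
  qed

  have char_sum: "char (distr M borel (\<lambda>\<omega>. \<Sum>i\<in>I n. \<xi> n i \<omega>)) t = (\<Prod>i\<in>I n. \<phi> n i)" for n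
    unfolding \<phi>_def by (rule char_distr_sum[OF indep])
  have prod_\<psi>: "(\<Prod>i\<in>I n. \<psi> n i) = complex_of_real (exp (- (t\<^sup>2 * V n / 2)))" for n
  \<comment> \<open>For infinite \<open>I n\<close> the product is 1 and \<open>V n\<close> is 0 by
    convention, so the identity persists.\<close>
  proof (cases "finite (I n)")
    case True
    then show ?thesis
      by (simp add: \<psi>_def V_def sum_distrib_left sum_divide_distrib exp_sum flip: sum_negf of_real_prod)
  qed (simp add: V_def)
  \<comment> \<open>All factors have modulus at most 1, so the products differ by at most the sum of
    the differences of the factors.\<close>
  have "cmod ((\<Prod>i\<in>I n. \<phi> n i) - (\<Prod>i\<in>I n. \<psi> n i)) \<le> (\<bar>t\<bar> ^ 3 * B n + t ^ 4 * (B n)\<^sup>2) * V n" for n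
  proof -
    have "cmod ((\<Prod>i\<in>I n. \<phi> n i) - (\<Prod>i\<in>I n. \<psi> n i)) \<le> (\<Sum>i\<in>I n. cmod (\<phi> n i - \<psi> n i))"
    proof (rule norm_prod_diff)
      fix i assume i: "i \<in> I n"
      interpret D: real_distribution "distr M borel (\<xi> n i)"
        by (rule real_distribution_distr[OF rv[OF i]])
      show "cmod (\<phi> n i) \<le> 1" unfolding \<phi>_def by (rule D.cmod_char_le_1)
      show "cmod (\<psi> n i) \<le> 1" using s_nonneg[of n i] by (simp add: \<psi>_def)
    qed
    also have "\<dots> \<le> (\<Sum>i\<in>I n. (\<bar>t\<bar> ^ 3 * B n + t ^ 4 * (B n)\<^sup>2) * s n i)"
      by (intro sum_mono local_bound)
    finally show ?thesis by (simp add: V_def sum_distrib_left)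
  qed
  moreover have "(\<lambda>n. (\<bar>t\<bar> ^ 3 * B n + t ^ 4 * (B n)\<^sup>2) * V n) \<longlonglongrightarrow> (\<bar>t\<bar> ^ 3 * 0 + t ^ 4 * 0\<^sup>2) * \<tau>"
    by (intro tendsto_intros B V)
  then have "(\<lambda>n. (\<bar>t\<bar> ^ 3 * B n + t ^ 4 * (B n)\<^sup>2) * V n) \<longlonglongrightarrow> 0" by simp
  ultimately have "(\<lambda>n. (\<Prod>i\<in>I n. \<phi> n i) - (\<Prod>i\<in>I n. \<psi> n i)) \<longlonglongrightarrow> 0"
    by (rule Lim_null_comparison[OF always_eventually[OF allI]])
  moreover have "(\<lambda>n. \<Prod>i\<in>I n. \<psi> n i) \<longlonglongrightarrow> complex_of_real (exp (- (t\<^sup>2 * \<tau> / 2)))"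
    unfolding prod_\<psi> by (intro tendsto_intros V) simp
  ultimately have "(\<lambda>n. \<Prod>i\<in>I n. \<phi> n i) \<longlonglongrightarrow> complex_of_real (exp (- (t\<^sup>2 * \<tau> / 2)))"
    using tendsto_add by fastforce
  then show "(\<lambda>n. char (distr M borel (\<lambda>\<omega>. \<Sum>i\<in>I n. \<xi> n i \<omega>)) t)
      \<longlonglongrightarrow> char (distr std_normal_distribution borel (\<lambda>z. sqrt \<tau> * z)) t"
    using \<open>0 \<le> \<tau>\<close> by (simp add: char_sum char_scaled_std_normal power_mult_distrib)
qed (rule real_distribution_scaled_std_normal)

text \<open>Independence and centering remove the cross term between a new summand and the partial
  sum. Integrability is part of the conclusion because the induction step needs it for the square of
  the partial sum.\<close>

lemma (in prob_space) second_moment_sum_indep: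
  fixes \<xi> :: "'i \<Rightarrow> 'a \<Rightarrow> real"
  assumes indep: "indep_vars (\<lambda>_. borel) \<xi> I"
    and mean: "\<And>i. i \<in> I \<Longrightarrow> expectation (\<xi> i) = 0"
    and int: "\<And>i. i \<in> I \<Longrightarrow> integrable M (\<lambda>\<omega>. (\<xi> i \<omega>)\<^sup>2)"
  shows "integrable M (\<lambda>\<omega>. (\<Sum>i\<in>I. \<xi> i \<omega>)\<^sup>2) \<and>
    expectation (\<lambda>\<omega>. (\<Sum>i\<in>I. \<xi> i \<omega>)\<^sup>2) = (\<Sum>i\<in>I. expectation (\<lambda>\<omega>. (\<xi> i \<omega>)\<^sup>2))"
  using assms
proof (induction I rule: infinite_finite_induct)
  case (insert x F)
  have rv: "\<xi> i \<in> borel_measurable M" if "i \<in> insert x F" for i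
    using insert.prems(1) that unfolding indep_vars_def2 by auto
  have int1: "integrable M (\<xi> i)" if "i \<in> insert x F" for i
    by (rule square_integrable_imp_integrable[OF rv[OF that] insert.prems(3)[OF that]])
  have ind: "indep_var borel (\<xi> x) borel (\<lambda>\<omega>. \<Sum>i\<in>F. \<xi> i \<omega>)"
    by (rule indep_vars_sum[OF insert.hyps(1,2) insert.prems(1)])
  have intF: "integrable M (\<lambda>\<omega>. \<Sum>i\<in>F. \<xi> i \<omega>)" using int1 by auto
  have IH: "integrable M (\<lambda>\<omega>. (\<Sum>i\<in>F. \<xi> i \<omega>)\<^sup>2)"
    "expectation (\<lambda>\<omega>. (\<Sum>i\<in>F. \<xi> i \<omega>)\<^sup>2) = (\<Sum>i\<in>F. expectation (\<lambda>\<omega>. (\<xi> i \<omega>)\<^sup>2))"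
    using insert.IH[OF indep_vars_subset[OF insert.prems(1)]] insert.prems by auto
  have cross: "integrable M (\<lambda>\<omega>. \<xi> x \<omega> * (\<Sum>i\<in>F. \<xi> i \<omega>))"
    "expectation (\<lambda>\<omega>. \<xi> x \<omega> * (\<Sum>i\<in>F. \<xi> i \<omega>)) = 0"
    using indep_var_integrable[OF ind _ intF] indep_var_lebesgue_integral[OF ind _ intF]
      int1[of x] insert.prems(2)[of x] by auto
  have "(\<Sum>i\<in>insert x F. \<xi> i \<omega>)\<^sup>2
      = (\<xi> x \<omega>)\<^sup>2 + 2 * (\<xi> x \<omega> * (\<Sum>i\<in>F. \<xi> i \<omega>)) + (\<Sum>i\<in>F. \<xi> i \<omega>)\<^sup>2" for \<omega>
    using insert.hyps by (simp add: power2_sum algebra_simps)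
  then show ?case
    using IH cross insert.prems(3)[of x] insert.hyps by simp
qed simp_all

subsection \<open>The distribution of one observation\<close>

lemma square_sum_upto:
  fixes a :: "nat \<Rightarrow> real"
  shows "(\<Sum>k=1..b. a k)\<^sup>2 = (\<Sum>k=1..b. (a k)\<^sup>2) + 2 * (\<Sum>k=1..b. \<Sum>s=k+1..b. a k * a s)"
proof (induction b)
  case (Suc b)
  \<comment> \<open>The inner sum for \<open>k = Suc b\<close> is empty; every other inner sum gains
    the term \<open>s = Suc b\<close>.\<close>
  have "(\<Sum>k=1..Suc b. \<Sum>s=k+1..Suc b. a k * a s)
      = (\<Sum>k=1..b. (\<Sum>s=k+1..b. a k * a s) + a k * a (Suc b))"
    by simp
  then show ?case
    using Suc by (simp add: sum.distrib power2_sum algebra_simps sum_distrib_left sum_distrib_right)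
qed simp

text \<open>Separates what holds for any fixed number of labels from the growth conditions on
  \<open>r\<close>, which are added in \<open>partially_labeled_sample\<close>.\<close>

locale labeled_sample = prob_space M for M :: "'w measure" +
  fixes X :: "'w \<Rightarrow> 'x::euclidean_space" and Y :: "'w \<Rightarrow> real ^ 'c"
    and Xs :: "nat \<Rightarrow> 'w \<Rightarrow> 'x" and Ys :: "nat \<Rightarrow> 'w \<Rightarrow> real ^ 'c"
    and v :: "nat \<Rightarrow> 'x" and b :: nat and j :: 'c
  assumes X_rv [measurable]: "X \<in> borel_measurable M" and Y_rv [measurable]: "Y \<in> borel_measurable M"
    and Y_01: "AE \<omega> in M. Y \<omega> $ j \<in> {0, 1}"
    and v_inj: "inj_on v {1..b}"
    and X_discrete: "AE \<omega> in M. X \<omega> \<in> v ` {1..b}"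
    and p_pos: "\<And>k. k \<in> {1..b} \<Longrightarrow> 0 < val_prob M X v k"
    and sample_indep: "indep_vars (\<lambda>_. borel) (\<lambda>i \<omega>. (Xs i \<omega>, Ys i \<omega>)) {1..}"
    and sample_law: "\<And>i. 1 \<le> i \<Longrightarrow>
          distr M borel (\<lambda>\<omega>. (Xs i \<omega>, Ys i \<omega>)) = distr M borel (\<lambda>\<omega>. (X \<omega>, Y \<omega>))"
begin

abbreviation "p \<equiv> val_prob M X v"
abbreviation "d \<equiv> class_prob M X Y v j"
abbreviation "q \<equiv> expectation (\<lambda>\<omega>. Y \<omega> $ j)"
abbreviation "obs \<omega> \<equiv> (X \<omega>, Y \<omega>)"
abbreviation "Z i \<omega> \<equiv> (Xs i \<omega>, Ys i \<omega>)"

text \<open>This and the next functions act on the pair \<open>(x, y)\<close>, so that law and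
  independence of the observations pass to them by composition.\<close>

definition cell :: "nat \<Rightarrow> 'x \<times> (real ^ 'c) \<Rightarrow> real" where
  "cell k z = of_bool (fst z = v k)"

definition resid :: "nat \<Rightarrow> 'x \<times> (real ^ 'c) \<Rightarrow> real" where
  "resid k z = cell k z * (snd z $ j - d k)"

definition noise :: "'x \<times> (real ^ 'c) \<Rightarrow> real" where
  "noise z = (\<Sum>k=1..b. resid k z)"

definition trend :: "'x \<times> (real ^ 'c) \<Rightarrow> real" where
  "trend z = (\<Sum>k=1..b. d k * cell k z) - q"

text \<open>The almost sure range of an observation: bounds and identities are proved pointwise on
  it and then used almost surely.\<close>

definition admissible :: "'x \<times> (real ^ 'c) \<Rightarrow> bool" where
  "admissible z \<longleftrightarrow> fst z \<in> v ` {1..b} \<and> snd z $ j \<in> {0, 1}"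

lemma fst_borel [measurable]: "(fst :: 'x \<times> (real ^ 'c) \<Rightarrow> 'x) \<in> borel_measurable borel"
  by (intro borel_measurable_continuous_onI continuous_on_fst continuous_on_id)

lemma label_borel [measurable]: "(\<lambda>z :: 'x \<times> (real ^ 'c). snd z $ j) \<in> borel_measurable borel"
  by (intro borel_measurable_continuous_onI continuous_intros)

lemma cell_borel [measurable]: "cell k \<in> borel_measurable borel"
proof -
  have "Measurable.pred borel (\<lambda>z :: 'x \<times> (real ^ 'c). fst z = v k)" by measurable
  then show ?thesis unfolding cell_def[abs_def] of_bool_def by measurable
qed

lemma resid_borel [measurable]: "resid k \<in> borel_measurable borel"
  unfolding resid_def[abs_def] by measurable

lemma noise_borel [measurable]: "noise \<in> borel_measurable borel"
  unfolding noise_def[abs_def] by measurable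

lemma trend_borel [measurable]: "trend \<in> borel_measurable borel"
  unfolding trend_def[abs_def] by measurable

lemma admissible_borel [measurable]: "Measurable.pred borel admissible"
proof -
  have "admissible = (\<lambda>z. (\<exists>k\<in>{1..b}. fst z = v k) \<and> (snd z $ j = 0 \<or> snd z $ j = 1))"
    by (auto simp: admissible_def fun_eq_iff)
  then show ?thesis by simp
qed

lemma obs_rv [measurable]: "(\<lambda>\<omega>. obs \<omega>) \<in> borel_measurable M"
  by (intro borel_measurable_Pair X_rv Y_rv)

lemma Z_rv: "1 \<le> i \<Longrightarrow> (\<lambda>\<omega>. Z i \<omega>) \<in> borel_measurable M"
  using sample_indep unfolding indep_vars_def2 by auto

lemma rv_comp_Z: "1 \<le> i \<Longrightarrow> f \<in> borel_measurable borel \<Longrightarrow> (\<lambda>\<omega>. f (Z i \<omega>)) \<in> borel_measurable M"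
  using measurable_compose[OF Z_rv] .

lemma AE_obs: "AE \<omega> in M. admissible (obs \<omega>)"
  using X_discrete Y_01 by eventually_elim (simp add: admissible_def)

text \<open>The range is assumed for \<open>(X, Y)\<close> only; being a Borel condition, it passes
  to each observation by equality of laws.\<close>

lemma AE_Z:
  assumes "1 \<le> i"
  shows "AE \<omega> in M. admissible (Z i \<omega>)"
proof -
  have "AE z in distr M borel (\<lambda>\<omega>. obs \<omega>). admissible z"
    using AE_obs by (simp add: AE_distr_iff)
  then have "AE z in distr M borel (\<lambda>\<omega>. Z i \<omega>). admissible z"
    unfolding sample_law[OF assms] .
  then show ?thesis using Z_rv[OF assms] by (simp add: AE_distr_iff)
qed

lemma expectation_Z:
  fixes f :: "'x \<times> (real ^ 'c) \<Rightarrow> real"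
  assumes "1 \<le> i" and [measurable]: "f \<in> borel_measurable borel"
  shows "expectation (\<lambda>\<omega>. f (Z i \<omega>)) = expectation (\<lambda>\<omega>. f (obs \<omega>))"
proof -
  have "expectation (\<lambda>\<omega>. f (Z i \<omega>)) = integral\<^sup>L (distr M borel (\<lambda>\<omega>. Z i \<omega>)) f"
    using Z_rv[OF assms(1)] by (simp add: integral_distr)
  also have "\<dots> = expectation (\<lambda>\<omega>. f (obs \<omega>))"
    unfolding sample_law[OF assms(1)] by (simp add: integral_distr)
  finally show ?thesis .
qed

lemma integrable_obs:
  fixes f :: "'x \<times> (real ^ 'c) \<Rightarrow> real"
  assumes [measurable]: "f \<in> borel_measurable borel" and "\<And>z. admissible z \<Longrightarrow> \<bar>f z\<bar> \<le> C"
  shows "integrable M (\<lambda>\<omega>. f (obs \<omega>))"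
  using AE_obs assms(2) by (intro integrable_const_bound[where B=C]) auto

lemma integrable_Z:
  fixes f :: "'x \<times> (real ^ 'c) \<Rightarrow> real"
  assumes "1 \<le> i" "f \<in> borel_measurable borel" and "\<And>z. admissible z \<Longrightarrow> \<bar>f z\<bar> \<le> C"
  shows "integrable M (\<lambda>\<omega>. f (Z i \<omega>))"
  using AE_Z[OF assms(1)] assms by (intro integrable_const_bound[where B=C] rv_comp_Z) auto

text \<open>Injectivity of \<open>v\<close> makes the cells disjoint. The outcome is a Kronecker
  delta, through which \<open>sum_weighted_cell\<close> collapses sums over cells.\<close>

lemma admissible_cell:
  assumes "admissible z"
  obtains m where "m \<in> {1..b}" "\<And>k. k \<in> {1..b} \<Longrightarrow> cell k z = of_bool (k = m)"
proof -
  obtain m where "m \<in> {1..b}" "fst z = v m" using assms by (auto simp: admissible_def)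
  moreover from this have "cell k z = of_bool (k = m)" if "k \<in> {1..b}" for k
    using that v_inj by (auto simp: cell_def dest: inj_onD)
  ultimately show ?thesis using that by blast
qed

lemma sum_weighted_cell:
  assumes "m \<in> {1..b}" "\<And>k. k \<in> {1..b} \<Longrightarrow> cell k z = of_bool (k = m)"
  shows "(\<Sum>k=1..b. w k * cell k z) = w m"
proof -
  have "(\<Sum>k=1..b. w k * cell k z) = (\<Sum>k\<in>{1..b}. if k = m then w k else 0)"
    using assms(2) by (intro sum.cong) auto
  then show ?thesis using assms(1) by simp
qed

lemma abs_cell_le: "\<bar>cell k z\<bar> \<le> 1"
  by (simp add: cell_def)

section \<open>Moments of cells, residuals, noise and trend\<close>

lemma expectation_cell: "expectation (\<lambda>\<omega>. cell k (obs \<omega>)) = p k"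
proof -
  have "expectation (\<lambda>\<omega>. cell k (obs \<omega>)) = expectation (indicator {\<omega> \<in> space M. X \<omega> = v k})"
    by (intro Bochner_Integration.integral_cong) (auto simp: cell_def)
  then show ?thesis by (simp add: val_prob_def)
qed

text \<open>Valid for every \<open>k\<close>: if \<open>v k\<close> has probability 0, the
  conditional probability is 0 by division by zero.\<close>

lemma class_prob_bounds: "0 \<le> d k" "d k \<le> 1"
proof -
  have "\<P>(\<omega> in M. Y \<omega> $ j = 1 \<and> X \<omega> = v k) \<le> \<P>(\<omega> in M. X \<omega> = v k)"
    by (intro finite_measure_mono) auto
  then show "d k \<le> 1" by (simp add: class_prob_def cond_prob_def divide_le_eq_1 measure_le_0_iff)
      (metis measure_nonneg order_le_less)
  show "0 \<le> d k" by (simp add: class_prob_def cond_prob_def)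
qed

text \<open>The label is almost surely 0 or 1, so the integrand is the indicator of a joint event,
  and positivity of \<open>p k\<close> lets the quotient in \<open>d k\<close> be multiplied
  back.\<close>

lemma expectation_cell_label:
  assumes "k \<in> {1..b}"
  shows "expectation (\<lambda>\<omega>. cell k (obs \<omega>) * Y \<omega> $ j) = d k * p k"
proof -
  have [measurable]: "(\<lambda>\<omega>. Y \<omega> $ j) \<in> borel_measurable M"
    using measurable_compose[OF obs_rv label_borel] by simp
  have "expectation (\<lambda>\<omega>. cell k (obs \<omega>) * Y \<omega> $ j)
      = expectation (indicator {\<omega> \<in> space M. Y \<omega> $ j = 1 \<and> X \<omega> = v k})"
  proof (intro integral_cong_AE)
    show "AE \<omega> in M. cell k (obs \<omega>) * Y \<omega> $ j = indicator {\<omega> \<in> space M. Y \<omega> $ j = 1 \<and> X \<omega> = v k} \<omega>"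
      using Y_01 AE_space by eventually_elim (auto simp: cell_def)
  qed measurable
  also have "\<dots> = d k * p k"
    using p_pos[OF assms] by (simp add: class_prob_def cond_prob_def val_prob_def)
  finally show ?thesis .
qed

lemma expectation_resid:
  assumes "k \<in> {1..b}"
  shows "expectation (\<lambda>\<omega>. resid k (obs \<omega>)) = 0"
proof -
  have "integrable M (\<lambda>\<omega>. cell k (obs \<omega>) * snd (obs \<omega>) $ j)"
    by (rule integrable_obs[where C=1]) (auto simp: admissible_def cell_def)
  moreover have "integrable M (\<lambda>\<omega>. cell k (obs \<omega>))"
    by (rule integrable_obs[where C=1]) (auto simp: abs_cell_le)
  moreover have "resid k (obs \<omega>) = cell k (obs \<omega>) * Y \<omega> $ j - d k * cell k (obs \<omega>)" for \<omega>
    by (simp add: resid_def algebra_simps)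
  ultimately show ?thesis
    using expectation_cell_label[OF assms] by (simp add: expectation_cell)
qed

text \<open>Law of total expectation: almost surely exactly one cell is occupied.\<close>

lemma q_eq: "q = (\<Sum>k=1..b. d k * p k)"
proof -
  have int: "integrable M (\<lambda>\<omega>. cell k (obs \<omega>) * snd (obs \<omega>) $ j)" for k
    by (rule integrable_obs[where C=1]) (auto simp: admissible_def cell_def)
  have "q = expectation (\<lambda>\<omega>. \<Sum>k=1..b. cell k (obs \<omega>) * snd (obs \<omega>) $ j)"
  proof (intro integral_cong_AE)
    show "AE \<omega> in M. Y \<omega> $ j = (\<Sum>k=1..b. cell k (obs \<omega>) * snd (obs \<omega>) $ j)"
      using AE_obs
    proof eventually_elim
      case (elim \<omega>)
      then obtain m where "m \<in> {1..b}" "\<And>k. k \<in> {1..b} \<Longrightarrow> cell k (obs \<omega>) = of_bool (k = m)"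
        using admissible_cell by blast
      from sum_weighted_cell[OF this, of "\<lambda>_. Y \<omega> $ j"] show ?case by (simp add: mult.commute)
    qed
  qed (use int measurable_compose[OF obs_rv label_borel] in \<open>auto intro!: borel_measurable_sum borel_measurable_integrable\<close>)
  also have "\<dots> = (\<Sum>k=1..b. d k * p k)"
    using int expectation_cell_label by simp
  finally show ?thesis .
qed

lemma sum_p: "(\<Sum>k=1..b. p k) = 1"
proof -
  have int: "integrable M (\<lambda>\<omega>. cell k (obs \<omega>))" for k
    by (rule integrable_obs[where C=1]) (auto simp: abs_cell_le)
  have "(\<Sum>k=1..b. p k) = expectation (\<lambda>\<omega>. \<Sum>k=1..b. cell k (obs \<omega>))"
    using int by (simp add: expectation_cell)
  also have "\<dots> = expectation (\<lambda>_. 1)"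
  proof (intro integral_cong_AE)
    show "AE \<omega> in M. (\<Sum>k=1..b. cell k (obs \<omega>)) = 1"
      using AE_obs
    proof eventually_elim
      case (elim \<omega>)
      then obtain m where "m \<in> {1..b}" "\<And>k. k \<in> {1..b} \<Longrightarrow> cell k (obs \<omega>) = of_bool (k = m)"
        using admissible_cell by blast
      from sum_weighted_cell[OF this, of "\<lambda>_. 1"] show ?case by simp
    qed
  qed auto
  finally show ?thesis by (simp add: prob_space)
qed

lemma abs_noise_le:
  assumes "admissible z"
  shows "\<bar>noise z\<bar> \<le> 1"
proof -
  obtain m where m: "m \<in> {1..b}" "\<And>k. k \<in> {1..b} \<Longrightarrow> cell k z = of_bool (k = m)"
    using admissible_cell[OF assms] by blast
  have "noise z = snd z $ j - d m"
    using sum_weighted_cell[OF m, of "\<lambda>k. snd z $ j - d k"] by (simp add: noise_def resid_def mult.commute)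
  then show ?thesis using assms class_prob_bounds[of m] by (auto simp: admissible_def)
qed

lemma abs_resid_le: "admissible z \<Longrightarrow> \<bar>resid k z\<bar> \<le> 1"
  using class_prob_bounds[of k] by (auto simp: resid_def cell_def admissible_def)

text \<open>In the occupied cell \<open>m\<close> the trend is \<open>d m - q\<close>.\<close>

lemma abs_trend_le:
  assumes "admissible z"
  shows "\<bar>trend z\<bar> \<le> 1 + \<bar>q\<bar>"
proof -
  obtain m where m: "m \<in> {1..b}" "\<And>k. k \<in> {1..b} \<Longrightarrow> cell k z = of_bool (k = m)"
    using admissible_cell[OF assms] by blast
  show ?thesis using class_prob_bounds[of m] sum_weighted_cell[OF m, of d] by (simp add: trend_def)
qed

lemma expectation_noise: "expectation (\<lambda>\<omega>. noise (obs \<omega>)) = 0"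
proof -
  have "integrable M (\<lambda>\<omega>. resid k (obs \<omega>))" for k
    by (rule integrable_obs[OF _ abs_resid_le]) auto
  then show ?thesis by (simp add: noise_def expectation_resid)
qed

lemma expectation_trend: "expectation (\<lambda>\<omega>. trend (obs \<omega>)) = 0"
proof -
  have "integrable M (\<lambda>\<omega>. cell k (obs \<omega>))" for k
    by (rule integrable_obs[where C=1]) (auto simp: abs_cell_le)
  then have "expectation (\<lambda>\<omega>. trend (obs \<omega>)) = (\<Sum>k=1..b. d k * p k) - q"
    by (simp add: trend_def expectation_cell prob_space)
  then show ?thesis using q_eq by simp
qed

text \<open>The trend is constant on each cell and the noise has mean 0 within each cell: the
  orthogonality of a residual to functions of the conditioning variable.\<close>

lemma expectation_noise_trend: "expectation (\<lambda>\<omega>. noise (obs \<omega>) * trend (obs \<omega>)) = 0"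
proof -
  have int: "integrable M (\<lambda>\<omega>. resid k (obs \<omega>))" for k
    by (rule integrable_obs[OF _ abs_resid_le]) auto
  have "expectation (\<lambda>\<omega>. noise (obs \<omega>) * trend (obs \<omega>))
      = expectation (\<lambda>\<omega>. \<Sum>k=1..b. (d k - q) * resid k (obs \<omega>))"
  proof (intro integral_cong_AE)
    show "AE \<omega> in M. noise (obs \<omega>) * trend (obs \<omega>) = (\<Sum>k=1..b. (d k - q) * resid k (obs \<omega>))"
      using AE_obs
    proof eventually_elim
      case (elim \<omega>)
      then obtain m where m: "m \<in> {1..b}" "\<And>k. k \<in> {1..b} \<Longrightarrow> cell k (obs \<omega>) = of_bool (k = m)"
        using admissible_cell by blast
      show ?case
        using sum_weighted_cell[OF m, of "\<lambda>k. Y \<omega> $ j - d k"] sum_weighted_cell[OF m, of d]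
          sum_weighted_cell[OF m, of "\<lambda>k. (d k - q) * (Y \<omega> $ j - d k)"]
        by (simp add: noise_def trend_def resid_def mult_ac)
    qed
  qed auto
  also have "\<dots> = 0"
    using int by (simp add: expectation_resid)
  finally show ?thesis .
qed

text \<open>In the usual terms, \<open>noise_var\<close> is the mean conditional variance of the
  label given \<open>X\<close>, and \<open>trend_var\<close> is the variance of its conditional
  mean.\<close>

definition noise_var :: real where "noise_var = expectation (\<lambda>\<omega>. (noise (obs \<omega>))\<^sup>2)"
definition trend_var :: real where "trend_var = expectation (\<lambda>\<omega>. (trend (obs \<omega>))\<^sup>2)"

lemma trend_var_eq: "trend_var = (\<Sum>k=1..b. (d k - q)\<^sup>2 * p k)"
proof -
  have int: "integrable M (\<lambda>\<omega>. cell k (obs \<omega>))" for k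
    by (rule integrable_obs[where C=1]) (auto simp: abs_cell_le)
  have "trend_var = expectation (\<lambda>\<omega>. \<Sum>k=1..b. (d k - q)\<^sup>2 * cell k (obs \<omega>))"
    unfolding trend_var_def
  proof (intro integral_cong_AE)
    show "AE \<omega> in M. (trend (obs \<omega>))\<^sup>2 = (\<Sum>k=1..b. (d k - q)\<^sup>2 * cell k (obs \<omega>))"
      using AE_obs
    proof eventually_elim
      case (elim \<omega>)
      then obtain m where m: "m \<in> {1..b}" "\<And>k. k \<in> {1..b} \<Longrightarrow> cell k (obs \<omega>) = of_bool (k = m)"
        using admissible_cell by blast
      show ?case
        using sum_weighted_cell[OF m, of d] sum_weighted_cell[OF m, of "\<lambda>k. (d k - q)\<^sup>2"]
        by (simp add: trend_def)
    qed
  qed auto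
  then show ?thesis using int by (simp add: expectation_cell)
qed

text \<open>Second moment minus squared mean. The diagonal of the squared mean turns
  \<open>p k\<close> into \<open>p k * (1 - p k)\<close>; the rest are the multinomial
  covariances.\<close>

lemma trend_var_closed_form:
  "trend_var = (\<Sum>k=1..b. (d k)\<^sup>2 * p k * (1 - p k))
     - 2 * (\<Sum>k=1..b. \<Sum>s=k+1..b. d k * d s * p k * p s)"
proof -
  have "trend_var = (\<Sum>k=1..b. (d k)\<^sup>2 * p k - 2 * q * (d k * p k) + q\<^sup>2 * p k)"
    unfolding trend_var_eq by (intro sum.cong) (auto simp: power2_eq_square algebra_simps)
  also have "\<dots> = (\<Sum>k=1..b. (d k)\<^sup>2 * p k) - 2 * q * (\<Sum>k=1..b. d k * p k) + q\<^sup>2 * (\<Sum>k=1..b. p k)"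
    by (simp only: sum.distrib sum_subtractf sum_distrib_left)
  also have "\<dots> = (\<Sum>k=1..b. (d k)\<^sup>2 * p k) - (\<Sum>k=1..b. d k * p k)\<^sup>2"
    by (simp only: q_eq[symmetric] sum_p) (simp add: power2_eq_square)
  also have "\<dots> = (\<Sum>k=1..b. (d k)\<^sup>2 * p k - (d k * p k)\<^sup>2) - 2 * (\<Sum>k=1..b. \<Sum>s=k+1..b. (d k * p k) * (d s * p s))"
    unfolding square_sum_upto by (simp add: sum_subtractf)
  also have "(\<Sum>k=1..b. (d k)\<^sup>2 * p k - (d k * p k)\<^sup>2) = (\<Sum>k=1..b. (d k)\<^sup>2 * p k * (1 - p k))"
    by (intro sum.cong) (auto simp: power2_eq_square algebra_simps)
  finally show ?thesis by (simp add: mult_ac)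
qed

lemma noise_var_nonneg: "0 \<le> noise_var"
  by (simp add: noise_var_def)

lemma trend_var_nonneg: "0 \<le> trend_var"
  by (simp add: trend_var_def)

text \<open>If every \<open>d k\<close> were \<open>q\<close>, no two could differ; a cell with
  \<open>d k \<noteq> q\<close> contributes a positive term because \<open>p k\<close> is
  positive.\<close>

lemma trend_var_pos:
  assumes "\<exists>k\<in>{1..b}. \<exists>s\<in>{1..b}. d k \<noteq> d s"
  shows "0 < trend_var"
proof -
  obtain k where k: "k \<in> {1..b}" "d k \<noteq> q" using assms by metis
  then show ?thesis
    unfolding trend_var_eq using p_pos
    by (intro sum_pos2[where i=k]) (auto intro!: mult_nonneg_nonneg intro: less_imp_le)
qed

subsection \<open>Sums over the sample\<close>

lemma indep_comp_Z:
  assumes "I \<subseteq> {1..}" "\<And>i. F i \<in> borel_measurable borel"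
  shows "indep_vars (\<lambda>_. borel) (\<lambda>i \<omega>. F i (Z i \<omega>)) I"
  by (rule indep_vars_compose2[OF indep_vars_subset[OF sample_indep assms(1)]]) (rule assms(2))

text \<open>\<open>F\<close> depends on the position because labeled and unlabeled observations will
  enter with different weights.\<close>

lemma second_moment_sum_Z:
  fixes F :: "nat \<Rightarrow> 'x \<times> (real ^ 'c) \<Rightarrow> real"
  assumes F: "\<And>i. F i \<in> borel_measurable borel" and bound: "\<And>i z. admissible z \<Longrightarrow> \<bar>F i z\<bar> \<le> C"
    and mean: "\<And>i. expectation (\<lambda>\<omega>. F i (obs \<omega>)) = 0"
  shows "integrable M (\<lambda>\<omega>. (\<Sum>i=1..n. F i (Z i \<omega>))\<^sup>2)"
    and "expectation (\<lambda>\<omega>. (\<Sum>i=1..n. F i (Z i \<omega>))\<^sup>2) = (\<Sum>i=1..n. expectation (\<lambda>\<omega>. (F i (obs \<omega>))\<^sup>2))"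
proof -
  have F2: "(\<lambda>z. (F i z)\<^sup>2) \<in> borel_measurable borel" for i
    using F[of i] by measurable
  have *: "integrable M (\<lambda>\<omega>. (\<Sum>i=1..n. F i (Z i \<omega>))\<^sup>2) \<and>
      expectation (\<lambda>\<omega>. (\<Sum>i=1..n. F i (Z i \<omega>))\<^sup>2) = (\<Sum>i=1..n. expectation (\<lambda>\<omega>. (F i (Z i \<omega>))\<^sup>2))"
  proof (rule second_moment_sum_indep)
    show "indep_vars (\<lambda>_. borel) (\<lambda>i \<omega>. F i (Z i \<omega>)) {1..n}"
      by (rule indep_comp_Z) (auto simp: F)
    fix i assume "i \<in> {1..n}"
    then have i: "1 \<le> i" by simp
    show "expectation (\<lambda>\<omega>. F i (Z i \<omega>)) = 0" using expectation_Z[OF i F] mean by simp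
    show "integrable M (\<lambda>\<omega>. (F i (Z i \<omega>))\<^sup>2)"
    proof (rule integrable_Z[OF i F2])
      fix z assume "admissible z"
      from power_mono[OF bound[OF this, of i], of 2] show "\<bar>(F i z)\<^sup>2\<bar> \<le> C\<^sup>2" by simp
    qed
  qed
  then show "integrable M (\<lambda>\<omega>. (\<Sum>i=1..n. F i (Z i \<omega>))\<^sup>2)" by simp
  have "expectation (\<lambda>\<omega>. (F i (Z i \<omega>))\<^sup>2) = expectation (\<lambda>\<omega>. (F i (obs \<omega>))\<^sup>2)" if "i \<in> {1..n}" for i
    using expectation_Z[OF _ F2] that by simp
  with * show "expectation (\<lambda>\<omega>. (\<Sum>i=1..n. F i (Z i \<omega>))\<^sup>2) = (\<Sum>i=1..n. expectation (\<lambda>\<omega>. (F i (obs \<omega>))\<^sup>2))"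
    by simp
qed

lemma sum_Z_rv:
  fixes F :: "nat \<Rightarrow> 'x \<times> (real ^ 'c) \<Rightarrow> real"
  assumes "\<And>i. F i \<in> borel_measurable borel" "1 \<le> m"
  shows "(\<lambda>\<omega>. \<Sum>i=m..n. F i (Z i \<omega>)) \<in> borel_measurable M"
  using assms by (intro borel_measurable_sum rv_comp_Z) auto

text \<open>Weak law of large numbers along any deterministic sample size tending to infinity, by
  Chebyshev's inequality; needed for the labeled observations and for all of them.\<close>

lemma average_consistent:
  fixes f :: "'x \<times> (real ^ 'c) \<Rightarrow> real"
  assumes f [measurable]: "f \<in> borel_measurable borel" and bound: "\<And>z. admissible z \<Longrightarrow> \<bar>f z\<bar> \<le> C"
    and mean: "expectation (\<lambda>\<omega>. f (obs \<omega>)) = a"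
    and m: "filterlim m at_top sequentially"
  shows "asymp_equivalent M (\<lambda>n \<omega>. (\<Sum>i=1..m n. f (Z i \<omega>)) / real (m n)) (\<lambda>_ _. a)"
proof (rule asymp_equivalent_second_moment)
  have [measurable]: "(\<lambda>\<omega>. \<Sum>i=1..m n. f (Z i \<omega>)) \<in> borel_measurable M" for n
    by (rule sum_Z_rv) auto
  show "(\<lambda>\<omega>. (\<Sum>i=1..m n. f (Z i \<omega>)) / real (m n)) \<in> borel_measurable M" for n by measurable
  let ?F = "\<lambda>(i::nat) z. f z - a"
  let ?s = "expectation (\<lambda>\<omega>. (f (obs \<omega>) - a)\<^sup>2)"
  have F: "?F i \<in> borel_measurable borel" for i by measurable
  have C: "\<bar>?F i z\<bar> \<le> C + \<bar>a\<bar>" if "admissible z" for i z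
    using bound[OF that] by linarith
  have F0: "expectation (\<lambda>\<omega>. ?F i (obs \<omega>)) = 0" for i
    using integrable_obs[OF f bound] mean by (simp add: prob_space)
  note sm = second_moment_sum_Z[of ?F "C + \<bar>a\<bar>", OF F C F0]
  have eq: "((\<Sum>i=1..m n. f (Z i \<omega>)) / real (m n) - a)\<^sup>2 = (\<Sum>i=1..m n. f (Z i \<omega>) - a)\<^sup>2 / (real (m n))\<^sup>2"
    if "1 \<le> m n" for n \<omega>
  proof -
    have "(\<Sum>i=1..m n. f (Z i \<omega>)) / real (m n) - a = (\<Sum>i=1..m n. f (Z i \<omega>) - a) / real (m n)"
      using that by (simp add: sum_subtractf field_simps)
    then show ?thesis by (simp add: power_divide)
  qed
  show "integrable M (\<lambda>\<omega>. ((\<Sum>i=1..m n. f (Z i \<omega>)) / real (m n) - a)\<^sup>2)" for n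
  \<comment> \<open>For \<open>m n = 0\<close> the average is 0 by division by zero and the
    integrand is constant.\<close>
  proof (cases "1 \<le> m n")
    case True
    show ?thesis unfolding eq[OF True] using sm(1)[of "m n"] by simp
  qed (simp add: not_le)
  have ev: "\<forall>\<^sub>F n in sequentially. 1 \<le> m n"
    using m unfolding filterlim_at_top by blast
  have "(\<lambda>n. ?s / real (m n)) \<longlonglongrightarrow> 0"
    by (intro tendsto_divide_0[OF tendsto_const] filterlim_at_top_imp_at_infinity
        filterlim_compose[OF filterlim_real_sequentially m])
  moreover have "\<forall>\<^sub>F n in sequentially. ?s / real (m n)
      = expectation (\<lambda>\<omega>. ((\<Sum>i=1..m n. f (Z i \<omega>)) / real (m n) - a)\<^sup>2)"
    using ev
  proof eventually_elim
    case (elim n)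
    show ?case unfolding eq[OF elim] using sm(2)[of "m n"] by (simp add: power2_eq_square)
  qed
  ultimately show "(\<lambda>n. expectation (\<lambda>\<omega>. ((\<Sum>i=1..m n. f (Z i \<omega>)) / real (m n) - a)\<^sup>2)) \<longlonglongrightarrow> 0"
    by (rule Lim_transform_eventually)
qed auto

section \<open>The estimators as sums over the sample\<close>

lemma labeled_count_eq: "labeled_count Xs v r k \<omega> = (\<Sum>i=1..r. cell k (Z i \<omega>))"
  by (simp add: labeled_count_def cell_def)

text \<open>The case \<open>r = n\<close> is included on purpose: it is the estimator without
  unlabeled data.\<close>

lemma p_hat_eq:
  assumes "r \<le> n"
  shows "p_hat Xs v r n k \<omega> = (\<Sum>i=1..n. cell k (Z i \<omega>)) / real n"
proof -
  have "(\<Sum>i=1..n. cell k (Z i \<omega>)) = (\<Sum>i=1..r. cell k (Z i \<omega>)) + (\<Sum>i=r+1..n. cell k (Z i \<omega>))"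
    using sum.ub_add_nat[of 1 r "\<lambda>i. cell k (Z i \<omega>)" "n - r"] assms by simp
  then show ?thesis
    by (simp add: p_hat_def labeled_count_def unlabeled_count_def cell_def)
qed

text \<open>Centering for a ratio estimator: subtracting \<open>d k\<close> times the random
  denominator from the numerator leaves a sum of centered independent terms.\<close>

lemma class_count_eq:
  "class_count Xs Ys v r j k \<omega> - d k * labeled_count Xs v r k \<omega> = (\<Sum>i=1..r. resid k (Z i \<omega>))"
  by (simp add: class_count_def labeled_count_def resid_def cell_def sum_subtractf sum_distrib_left algebra_simps)

text \<open>Interchanging the sums exhibits an average of independent, identically distributed
  terms, which is why the variance is known exactly for every \<open>n\<close>.\<close>

lemma sum_d_p_hat:
  assumes "r \<le> n" "1 \<le> n"
  shows "(\<Sum>k=1..b. d k * p_hat Xs v r n k \<omega>) = q + (\<Sum>i=1..n. trend (Z i \<omega>)) / real n"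
proof -
  have "(\<Sum>k=1..b. d k * p_hat Xs v r n k \<omega>) = (\<Sum>k=1..b. \<Sum>i=1..n. d k * cell k (Z i \<omega>)) / real n"
    by (simp add: p_hat_eq[OF assms(1)] sum_distrib_left sum_divide_distrib)
  also have "(\<Sum>k=1..b. \<Sum>i=1..n. d k * cell k (Z i \<omega>)) = (\<Sum>i=1..n. \<Sum>k=1..b. d k * cell k (Z i \<omega>))"
    by (rule sum.swap)
  also have "\<dots> = (\<Sum>i=1..n. trend (Z i \<omega>)) + real n * q"
    by (simp add: trend_def sum_subtractf)
  finally show ?thesis using assms(2) by (simp add: field_simps)
qed

lemma labeled_count_rv [measurable]: "labeled_count Xs v r k \<in> borel_measurable M"
  unfolding labeled_count_eq[abs_def] by (rule sum_Z_rv) auto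

lemma p_hat_rv [measurable]: "p_hat Xs v r n k \<in> borel_measurable M"
proof -
  have "unlabeled_count Xs v r n k = (\<lambda>\<omega>. \<Sum>i=r+1..n. cell k (Z i \<omega>))"
    by (simp add: unlabeled_count_def cell_def fun_eq_iff)
  then have [measurable]: "unlabeled_count Xs v r n k \<in> borel_measurable M"
    using sum_Z_rv[of "\<lambda>_. cell k" "r + 1" n] by simp
  show ?thesis unfolding p_hat_def[abs_def] by measurable
qed

lemma q_hat_rv [measurable]: "q_hat Xs Ys v b j r n \<in> borel_measurable M"
proof -
  have "class_count Xs Ys v r j k = (\<lambda>\<omega>. \<Sum>i=1..r. cell k (Z i \<omega>) * snd (Z i \<omega>) $ j)" for k
    by (simp add: class_count_def cell_def fun_eq_iff)
  then have [measurable]: "class_count Xs Ys v r j k \<in> borel_measurable M" for k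
    using sum_Z_rv[of "\<lambda>_ z. cell k z * snd z $ j" 1 r] by simp
  show ?thesis unfolding q_hat_def[abs_def] d_hat_def by measurable
qed

lemma Y_bar_eq: "Y_bar Ys j r \<omega> = (\<Sum>i=1..r. snd (Z i \<omega>) $ j) / real r"
  by (simp add: Y_bar_def)

lemma Y_bar_rv [measurable]: "Y_bar Ys j r \<in> borel_measurable M"
proof -
  have [measurable]: "(\<lambda>\<omega>. \<Sum>i=1..r. snd (Z i \<omega>) $ j) \<in> borel_measurable M"
    by (rule sum_Z_rv[of "\<lambda>_ z. snd z $ j"]) auto
  show ?thesis unfolding Y_bar_eq[abs_def] by measurable
qed

lemma variance_sum_d_p_hat:
  assumes "r \<le> n" "1 \<le> n"
  shows "variance (\<lambda>\<omega>. \<Sum>k=1..b. d k * p_hat Xs v r n k \<omega>) = 1 / real n * trend_var"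
proof -
  let ?T = "\<lambda>\<omega>. \<Sum>i=1..n. trend (Z i \<omega>)"
  note sm = second_moment_sum_Z[of "\<lambda>_. trend", OF trend_borel abs_trend_le expectation_trend, of n]
  have int: "integrable M ?T"
    by (intro Bochner_Integration.integrable_sum integrable_Z[OF _ trend_borel abs_trend_le]) auto
  have "expectation ?T = (\<Sum>i=1..n. expectation (\<lambda>\<omega>. trend (Z i \<omega>)))"
    by (intro Bochner_Integration.integral_sum integrable_Z[OF _ trend_borel abs_trend_le]) auto
  also have "\<dots> = 0"
    using expectation_Z[OF _ trend_borel] expectation_trend by simp
  finally have "expectation (\<lambda>\<omega>. \<Sum>k=1..b. d k * p_hat Xs v r n k \<omega>) = q"
    unfolding sum_d_p_hat[OF assms] using int by (simp add: prob_space)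
  then have "variance (\<lambda>\<omega>. \<Sum>k=1..b. d k * p_hat Xs v r n k \<omega>) = expectation (\<lambda>\<omega>. (?T \<omega>)\<^sup>2 / (real n)\<^sup>2)"
    unfolding sum_d_p_hat[OF assms] by (simp add: power_divide)
  also have "\<dots> = real n * trend_var / (real n)\<^sup>2"
    using sm(2) by (simp add: trend_var_def)
  finally show ?thesis using assms by (simp add: power2_eq_square)
qed

lemma AE_all_Z: "AE \<omega> in M. \<forall>i\<ge>1. admissible (Z i \<omega>)"
  using AE_Z by (auto simp: AE_all_countable)

text \<open>With \<open>n = r\<close> the labeled count cancels in each product, and the cells
  partition the observations almost surely.\<close>

lemma q_hat_labeled_only: "AE \<omega> in M. q_hat Xs Ys v b j r r \<omega> = Y_bar Ys j r \<omega>"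
  using AE_all_Z
proof eventually_elim
  case (elim \<omega>)
  have summand: "p_hat Xs v r r k \<omega> * d_hat Xs Ys v r j k \<omega> = class_count Xs Ys v r j k \<omega> / real r" for k
  proof (cases "labeled_count Xs v r k \<omega> = 0")
    case True
    \<comment> \<open>An empty cell has no class members either, so the cancellation survives the
      division by zero.\<close>
    then have "\<forall>i\<in>{1..r}. of_bool (Xs i \<omega> = v k) = (0 :: real)"
      unfolding labeled_count_def by (subst (asm) sum_nonneg_eq_0_iff) auto
    then have "class_count Xs Ys v r j k \<omega> = 0"
      unfolding class_count_def by (intro sum.neutral) auto
    then show ?thesis by (simp add: d_hat_def)
  next
    case False
    then show ?thesis by (simp add: d_hat_def p_hat_def unlabeled_count_def)
  qed
  have "q_hat Xs Ys v b j r r \<omega> = (\<Sum>k=1..b. class_count Xs Ys v r j k \<omega>) / real r"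
    by (simp add: q_hat_def summand sum_divide_distrib)
  also have "(\<Sum>k=1..b. class_count Xs Ys v r j k \<omega>) = (\<Sum>i=1..r. \<Sum>k=1..b. snd (Z i \<omega>) $ j * cell k (Z i \<omega>))"
    unfolding class_count_def by (subst sum.swap) (simp add: cell_def mult.commute)
  also have "\<dots> = (\<Sum>i=1..r. Ys i \<omega> $ j)"
  proof (intro sum.cong refl)
    fix i assume "i \<in> {1..r}"
    then have "admissible (Z i \<omega>)" using elim by simp
    then obtain m where "m \<in> {1..b}" "\<And>k. k \<in> {1..b} \<Longrightarrow> cell k (Z i \<omega>) = of_bool (k = m)"
      using admissible_cell by blast
    from sum_weighted_cell[OF this, of "\<lambda>_. Ys i \<omega> $ j"]
    show "(\<Sum>k=1..b. snd (Z i \<omega>) $ j * cell k (Z i \<omega>)) = Ys i \<omega> $ j" by simp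
  qed
  finally show ?case by (simp add: Y_bar_def)
qed

end

subsection \<open>Asymptotics of the estimators\<close>

locale partially_labeled_sample = labeled_sample M X Y Xs Ys v b j
  for M :: "'w measure" and X :: "'w \<Rightarrow> 'x::euclidean_space" and Y :: "'w \<Rightarrow> real ^ 'c"
    and Xs :: "nat \<Rightarrow> 'w \<Rightarrow> 'x" and Ys :: "nat \<Rightarrow> 'w \<Rightarrow> real ^ 'c"
    and v :: "nat \<Rightarrow> 'x" and b :: nat and j :: 'c +
  fixes r :: "nat \<Rightarrow> nat" and \<gamma> :: real
  assumes r_less: "\<And>n. 1 \<le> n \<Longrightarrow> r n < n"
    and r_ratio: "(\<lambda>n. real (r n) / real n) \<longlonglongrightarrow> \<gamma>"
    and r_unbounded: "filterlim r at_top sequentially"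
begin

lemma eventually_r_pos: "\<forall>\<^sub>F n in sequentially. 1 \<le> r n \<and> 1 \<le> n"
  using r_unbounded eventually_ge_at_top[of 1] unfolding filterlim_at_top
  by (auto intro: eventually_conj)

lemma inverse_sqrt_r_tendsto: "(\<lambda>n. K / sqrt (real (r n))) \<longlonglongrightarrow> 0"
  by (intro tendsto_divide_0[OF tendsto_const] filterlim_at_top_imp_at_infinity
      filterlim_compose[OF sqrt_at_top] filterlim_compose[OF filterlim_real_sequentially r_unbounded])

lemma \<gamma>_bounds: "0 \<le> \<gamma>" "\<gamma> \<le> 1"
proof -
  show "0 \<le> \<gamma>" by (rule tendsto_lowerbound[OF r_ratio]) auto
  have "real (r n) / real n \<le> 1" if "1 \<le> n" for n using r_less[OF that] by (simp add: divide_le_eq_1)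
  then show "\<gamma> \<le> 1"
    by (intro tendsto_upperbound[OF r_ratio] eventually_sequentiallyI[of 1]) auto
qed

lemma labeled_freq_consistent:
  "asymp_equivalent M (\<lambda>n \<omega>. labeled_count Xs v (r n) k \<omega> / real (r n)) (\<lambda>_ _. p k)"
  unfolding labeled_count_eq
  by (rule average_consistent[OF _ abs_cell_le expectation_cell r_unbounded]) auto

lemma p_hat_consistent: "asymp_equivalent M (\<lambda>n. p_hat Xs v (r n) n k) (\<lambda>_ _. p k)"
proof (rule asymp_equivalent_dominated[OF _ _ asymp_equivalent_refl])
  show "asymp_equivalent M (\<lambda>n \<omega>. (\<Sum>i=1..n. cell k (Z i \<omega>)) / real n) (\<lambda>_ _. p k)"
    by (rule average_consistent[OF _ abs_cell_le expectation_cell filterlim_ident]) auto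
  fix \<epsilon> :: real assume "0 < \<epsilon>"
  have "\<forall>\<^sub>F n in sequentially. AE \<omega> in M. \<epsilon> \<le> \<bar>p_hat Xs v (r n) n k \<omega> - p k\<bar> \<longrightarrow>
      \<epsilon> \<le> \<bar>(\<Sum>i=1..n. cell k (Z i \<omega>)) / real n - p k\<bar> \<or> \<epsilon> \<le> \<bar>(0::real) - 0\<bar>"
  \<comment> \<open>Index 0 is left out because \<open>r_less\<close> says nothing about
    \<open>r 0\<close>.\<close>
  proof (rule eventually_sequentiallyI[of 1])
    fix n :: nat assume "1 \<le> n"
    from p_hat_eq[OF less_imp_le[OF r_less[OF this]]]
    show "AE \<omega> in M. \<epsilon> \<le> \<bar>p_hat Xs v (r n) n k \<omega> - p k\<bar> \<longrightarrow>
      \<epsilon> \<le> \<bar>(\<Sum>i=1..n. cell k (Z i \<omega>)) / real n - p k\<bar> \<or> \<epsilon> \<le> \<bar>(0::real) - 0\<bar>" by simp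
  qed
  with \<open>0 < \<epsilon>\<close> show "\<exists>\<delta>>0. \<forall>\<^sub>F n in sequentially. AE \<omega> in M. \<epsilon> \<le> \<bar>p_hat Xs v (r n) n k \<omega> - p k\<bar> \<longrightarrow>
      \<delta> \<le> \<bar>(\<Sum>i=1..n. cell k (Z i \<omega>)) / real n - p k\<bar> \<or> \<delta> \<le> \<bar>(\<lambda>_ _. 0 :: real) n \<omega> - (\<lambda>_ _. 0) n \<omega>\<bar>"
    by blast
qed (auto intro!: borel_measurable_divide sum_Z_rv[where F="\<lambda>_. cell k"])

section \<open>Linearization of \<open>q_hat\<close>\<close>

definition resid_sum :: "nat \<Rightarrow> nat \<Rightarrow> 'w \<Rightarrow> real" where
  "resid_sum k n \<omega> = (\<Sum>i=1..r n. resid k (Z i \<omega>)) / sqrt (real (r n))"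

text \<open>Compares two estimates of \<open>p k\<close>, from all observations and from the labeled
  ones, so it tends to 0 in probability.\<close>

definition weight_error :: "nat \<Rightarrow> nat \<Rightarrow> 'w \<Rightarrow> real" where
  "weight_error k n \<omega> = p_hat Xs v (r n) n k \<omega> / (labeled_count Xs v (r n) k \<omega> / real (r n)) - 1"

text \<open>Nonzero only where \<open>d_hat\<close> is \<open>0\<close> by division by zero.\<close>

definition empty_cell_error :: "nat \<Rightarrow> nat \<Rightarrow> 'w \<Rightarrow> real" where
  "empty_cell_error k n \<omega> = - (sqrt (real (r n)) * p_hat Xs v (r n) n k \<omega> * d k
     * of_bool (labeled_count Xs v (r n) k \<omega> = 0))"

text \<open>The first-order influence of observation \<open>i\<close> on
  \<open>sqrt r * (q_hat - q)\<close>.\<close>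

definition linear_term :: "nat \<Rightarrow> nat \<Rightarrow> 'x \<times> (real ^ 'c) \<Rightarrow> real" where
  "linear_term n i z = of_bool (i \<le> r n) * (noise z / sqrt (real (r n))) + sqrt (real (r n)) / real n * trend z"

lemma linear_term_borel [measurable]: "linear_term n i \<in> borel_measurable borel"
  unfolding linear_term_def[abs_def] by measurable

lemma resid_sum_rv [measurable]: "resid_sum k n \<in> borel_measurable M"
proof -
  have [measurable]: "(\<lambda>\<omega>. \<Sum>i=1..r n. resid k (Z i \<omega>)) \<in> borel_measurable M"
    by (rule sum_Z_rv) auto
  show ?thesis unfolding resid_sum_def[abs_def] by measurable
qed

lemma weight_error_rv [measurable]: "weight_error k n \<in> borel_measurable M"
  unfolding weight_error_def[abs_def] by measurable

lemma empty_cell_error_rv [measurable]: "empty_cell_error k n \<in> borel_measurable M"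
  unfolding empty_cell_error_def[abs_def] of_bool_def by measurable

text \<open>
  The summand \<open>empty_cell_error\<close> makes the expansion exact on every sample point, including
  those where some value is missing among the labeled observations.
\<close>

lemma q_hat_expansion:
  assumes "1 \<le> r n" "1 \<le> n"
  shows "sqrt (real (r n)) * (q_hat Xs Ys v b j (r n) n \<omega> - q)
    = (\<Sum>i=1..n. linear_term n i (Z i \<omega>))
      + (\<Sum>k=1..b. resid_sum k n \<omega> * weight_error k n \<omega> + empty_cell_error k n \<omega>)"
proof -
  let ?s = "sqrt (real (r n))" and ?P = "\<lambda>k. p_hat Xs v (r n) n k \<omega>"
  let ?L = "\<lambda>k. labeled_count Xs v (r n) k \<omega>" and ?D = "\<lambda>k. d_hat Xs Ys v (r n) j k \<omega>"
  have rn: "r n \<le> n" using r_less[OF assms(2)] by simp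
  have s: "0 < ?s" "?s * ?s = real (r n)" using assms by auto
  \<comment> \<open>In a nonempty cell \<open>p_hat\<close> over the labeled frequency is
    \<open>1 + weight_error\<close>, and this factor multiplies \<open>resid_sum\<close>.\<close>
  have cell_error: "?s * ?P k * (?D k - d k)
      = resid_sum k n \<omega> + (resid_sum k n \<omega> * weight_error k n \<omega> + empty_cell_error k n \<omega>)" for k
  proof (cases "?L k = 0")
    \<comment> \<open>Here \<open>d_hat\<close> is 0 and \<open>weight_error\<close> is -1, both by
      division by zero: the two \<open>resid_sum\<close> terms cancel and exactly
      \<open>empty_cell_error\<close> remains.\<close>
    case True
    then show ?thesis by (simp add: d_hat_def weight_error_def empty_cell_error_def)
  next
    case False
    then have "?D k - d k = (\<Sum>i=1..r n. resid k (Z i \<omega>)) / ?L k"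
      using class_count_eq[of "r n" k \<omega>] by (simp add: d_hat_def field_simps)
    also have "\<dots> = ?s * resid_sum k n \<omega> / ?L k" using s by (simp add: resid_sum_def)
    finally have "?s * ?P k * (?D k - d k) = (?s * ?s) * ?P k * resid_sum k n \<omega> / ?L k"
      by (simp add: mult_ac)
    then show ?thesis
      using False by (simp add: s(2) weight_error_def empty_cell_error_def field_simps)
  qed
  have "q_hat Xs Ys v b j (r n) n \<omega> - q
      = (\<Sum>k=1..b. ?P k * (?D k - d k)) + ((\<Sum>k=1..b. d k * ?P k) - q)"
    by (simp add: q_hat_def sum_subtractf algebra_simps)
  also have "\<dots> = (\<Sum>k=1..b. ?P k * (?D k - d k)) + (\<Sum>i=1..n. trend (Z i \<omega>)) / real n"
    unfolding sum_d_p_hat[OF rn assms(2)] by simp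
  finally have "?s * (q_hat Xs Ys v b j (r n) n \<omega> - q)
      = (\<Sum>k=1..b. ?s * ?P k * (?D k - d k)) + (\<Sum>i=1..n. ?s / real n * trend (Z i \<omega>))"
    by (simp add: distrib_left sum_distrib_left sum_divide_distrib mult.assoc)
  also have "(\<Sum>k=1..b. ?s * ?P k * (?D k - d k)) = (\<Sum>k=1..b. resid_sum k n \<omega>)
      + (\<Sum>k=1..b. resid_sum k n \<omega> * weight_error k n \<omega> + empty_cell_error k n \<omega>)"
    unfolding cell_error by (rule sum.distrib)
  also have "(\<Sum>k=1..b. resid_sum k n \<omega>) = (\<Sum>i=1..r n. noise (Z i \<omega>) / ?s)"
    unfolding resid_sum_def noise_def sum_divide_distrib by (rule sum.swap)
  also have "\<dots> = (\<Sum>i=1..n. of_bool (i \<le> r n) * (noise (Z i \<omega>) / ?s))"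
    using rn by (intro sum.mono_neutral_cong_left) auto
  finally show ?thesis by (simp add: linear_term_def sum.distrib)
qed

lemma remainder_negligible:
  assumes k: "k \<in> {1..b}"
  shows "asymp_equivalent M (\<lambda>n \<omega>. resid_sum k n \<omega> * weight_error k n \<omega> + empty_cell_error k n \<omega>) (\<lambda>_ _. 0)"
proof -
  have "asymp_equivalent M (\<lambda>n \<omega>. resid_sum k n \<omega> * weight_error k n \<omega>) (\<lambda>_ _. 0)"
  proof (rule asymp_equivalent_mult_bounded_second_moment)
    show "asymp_equivalent M (weight_error k) (\<lambda>_ _. 0)"
      using asymp_equivalent_ratio[OF p_pos[OF k] p_hat_consistent labeled_freq_consistent]
      by (simp add: asymp_equivalent_def weight_error_def)
    note sm = second_moment_sum_Z[of "\<lambda>_. resid k", OF resid_borel abs_resid_le expectation_resid[OF k]]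
    show "integrable M (\<lambda>\<omega>. (resid_sum k n \<omega>)\<^sup>2)" for n
      using sm(1)[of "r n"] by (simp add: resid_sum_def power_divide)
    \<comment> \<open>An equality when \<open>r n\<close> is positive; for \<open>r n = 0\<close>
      the left side is 0.\<close>
    show "expectation (\<lambda>\<omega>. (resid_sum k n \<omega>)\<^sup>2) \<le> expectation (\<lambda>\<omega>. (resid k (obs \<omega>))\<^sup>2)" for n
      using sm(2)[of "r n"] by (simp add: resid_sum_def power_divide)
  qed auto
  \<comment> \<open>The factor \<open>sqrt r\<close> does no harm: the error is nonzero only when
    the labeled frequency is 0, at distance \<open>p k\<close> from its limit. Hence
    \<open>\<delta> = p k\<close> serves every \<open>\<epsilon>\<close>.\<close>
  moreover have "asymp_equivalent M (empty_cell_error k) (\<lambda>_ _. 0)"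
  proof (rule asymp_equivalent_dominated[OF _ labeled_freq_consistent[of k] asymp_equivalent_refl[of M "\<lambda>_ _. 0"]])
    fix \<epsilon> :: real assume "0 < \<epsilon>"
    then have "labeled_count Xs v (r n) k \<omega> = 0" if "\<epsilon> \<le> \<bar>empty_cell_error k n \<omega> - 0\<bar>" for n \<omega>
      using that by (cases "labeled_count Xs v (r n) k \<omega> = 0") (simp_all add: empty_cell_error_def)
    then show "\<exists>\<delta>>0. \<forall>\<^sub>F n in sequentially. AE \<omega> in M. \<epsilon> \<le> \<bar>empty_cell_error k n \<omega> - 0\<bar> \<longrightarrow>
        \<delta> \<le> \<bar>labeled_count Xs v (r n) k \<omega> / real (r n) - p k\<bar> \<or> \<delta> \<le> \<bar>(0::real) - 0\<bar>"
      using p_pos[OF k] by (intro exI[of _ "p k"] conjI always_eventually allI AE_I2) auto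
  qed auto
  ultimately show ?thesis
    using asymp_equivalent_add[of "\<lambda>n \<omega>. resid_sum k n \<omega> * weight_error k n \<omega>" "\<lambda>_ _. 0" "empty_cell_error k" "\<lambda>_ _. 0"]
    by simp
qed

lemma q_hat_linearization:
  "asymp_equivalent M (\<lambda>n \<omega>. sqrt (real (r n)) * (q_hat Xs Ys v b j (r n) n \<omega> - q))
     (\<lambda>n \<omega>. \<Sum>i=1..n. linear_term n i (Z i \<omega>))"
proof (rule asymp_equivalent_dominated[OF _ _ asymp_equivalent_refl[of M "\<lambda>_ _. 0"]])
  let ?R = "\<lambda>n \<omega>. \<Sum>k=1..b. resid_sum k n \<omega> * weight_error k n \<omega> + empty_cell_error k n \<omega>"
  have "asymp_equivalent M ?R (\<lambda>_ \<omega>. \<Sum>k=1..b. 0)"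
    by (rule asymp_equivalent_sum[of "{1..b}" "\<lambda>k n \<omega>. resid_sum k n \<omega> * weight_error k n \<omega> + empty_cell_error k n \<omega>"
          "\<lambda>_ _ _. 0"]) (auto intro: remainder_negligible)
  then show "asymp_equivalent M ?R (\<lambda>_ _. 0)" by simp
  fix \<epsilon> :: real assume "0 < \<epsilon>"
  have "\<forall>\<^sub>F n in sequentially. AE \<omega> in M.
      \<epsilon> \<le> \<bar>sqrt (real (r n)) * (q_hat Xs Ys v b j (r n) n \<omega> - q) - (\<Sum>i=1..n. linear_term n i (Z i \<omega>))\<bar> \<longrightarrow>
      \<epsilon> \<le> \<bar>?R n \<omega> - 0\<bar> \<or> \<epsilon> \<le> \<bar>(0::real) - 0\<bar>"
    using eventually_r_pos
  proof eventually_elim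
    case (elim n)
    then show ?case by (intro AE_I2) (simp only: q_hat_expansion, simp)
  qed
  with \<open>0 < \<epsilon>\<close> show "\<exists>\<delta>>0. \<forall>\<^sub>F n in sequentially. AE \<omega> in M.
      \<epsilon> \<le> \<bar>sqrt (real (r n)) * (q_hat Xs Ys v b j (r n) n \<omega> - q) - (\<Sum>i=1..n. linear_term n i (Z i \<omega>))\<bar> \<longrightarrow>
      \<delta> \<le> \<bar>?R n \<omega> - 0\<bar> \<or> \<delta> \<le> \<bar>(0::real) - 0\<bar>" by blast
qed auto

section \<open>Limit law of \<open>q_hat\<close>\<close>

lemma abs_linear_term_le:
  assumes "admissible z" "1 \<le> n"
  shows "\<bar>linear_term n i z\<bar> \<le> (2 + \<bar>q\<bar>) / sqrt (real (r n))"
proof -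
  let ?s = "sqrt (real (r n))"
  \<comment> \<open>This is \<open>r n \<le> n\<close>, and it puts the trend at the scale of the
    noise; for \<open>r n = 0\<close> both sides are 0.\<close>
  have "?s / real n \<le> 1 / ?s"
    using r_less[OF assms(2)] by (cases "r n = 0") (simp_all add: field_simps)
  then have "\<bar>?s / real n * trend z\<bar> \<le> 1 / ?s * (1 + \<bar>q\<bar>)"
    unfolding abs_mult using abs_trend_le[OF assms(1)] by (intro mult_mono) auto
  moreover have "\<bar>of_bool (i \<le> r n) * (noise z / ?s)\<bar> \<le> 1 / ?s"
    using abs_noise_le[OF assms(1)] by (auto simp: divide_right_mono)
  ultimately have "\<bar>linear_term n i z\<bar> \<le> 1 / ?s + 1 / ?s * (1 + \<bar>q\<bar>)"
    unfolding linear_term_def by linarith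
  also have "\<dots> = (2 + \<bar>q\<bar>) / ?s" by (simp add: add_divide_distrib)
  finally show ?thesis .
qed

lemma integrable_basic:
  "integrable M (\<lambda>\<omega>. noise (obs \<omega>))" "integrable M (\<lambda>\<omega>. trend (obs \<omega>))"
  "integrable M (\<lambda>\<omega>. (noise (obs \<omega>))\<^sup>2)" "integrable M (\<lambda>\<omega>. (trend (obs \<omega>))\<^sup>2)"
  "integrable M (\<lambda>\<omega>. noise (obs \<omega>) * trend (obs \<omega>))"
proof -
  show "integrable M (\<lambda>\<omega>. noise (obs \<omega>))" by (rule integrable_obs[OF _ abs_noise_le]) auto
  show "integrable M (\<lambda>\<omega>. trend (obs \<omega>))" by (rule integrable_obs[OF _ abs_trend_le]) auto
  have "\<bar>(noise z)\<^sup>2\<bar> \<le> 1" if "admissible z" for z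
    using power_mono[OF abs_noise_le[OF that], of 2] by simp
  then show "integrable M (\<lambda>\<omega>. (noise (obs \<omega>))\<^sup>2)"
    by (rule integrable_obs[of "\<lambda>z. (noise z)\<^sup>2", rotated]) auto
  have "\<bar>(trend z)\<^sup>2\<bar> \<le> (1 + \<bar>q\<bar>)\<^sup>2" if "admissible z" for z
    using power_mono[OF abs_trend_le[OF that], of 2] by simp
  then show "integrable M (\<lambda>\<omega>. (trend (obs \<omega>))\<^sup>2)"
    by (rule integrable_obs[of "\<lambda>z. (trend z)\<^sup>2", rotated]) auto
  have "\<bar>noise z * trend z\<bar> \<le> 1 * (1 + \<bar>q\<bar>)" if "admissible z" for z
    unfolding abs_mult using abs_noise_le[OF that] abs_trend_le[OF that] by (intro mult_mono) auto
  then show "integrable M (\<lambda>\<omega>. noise (obs \<omega>) * trend (obs \<omega>))"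
    by (rule integrable_obs[of "\<lambda>z. noise z * trend z", rotated]) auto
qed

lemma second_moment_combination:
  "expectation (\<lambda>\<omega>. (a * noise (obs \<omega>) + c * trend (obs \<omega>))\<^sup>2) = a\<^sup>2 * noise_var + c\<^sup>2 * trend_var"
proof -
  have "(a * noise z + c * trend z)\<^sup>2
      = a\<^sup>2 * (noise z)\<^sup>2 + c\<^sup>2 * (trend z)\<^sup>2 + 2 * a * c * (noise z * trend z)" for z
    by (simp add: power2_eq_square algebra_simps)
  then show ?thesis
    by (simp add: integrable_basic noise_var_def trend_var_def expectation_noise_trend)
qed

lemma expectation_combination:
  "expectation (\<lambda>\<omega>. a * noise (obs \<omega>) + c * trend (obs \<omega>)) = 0"
  by (simp add: integrable_basic expectation_noise expectation_trend)

lemma linear_term_alt: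
  "linear_term n i = (\<lambda>z. of_bool (i \<le> r n) / sqrt (real (r n)) * noise z + sqrt (real (r n)) / real n * trend z)"
  by (simp add: linear_term_def fun_eq_iff)

lemma expectation_linear_term: "expectation (\<lambda>\<omega>. linear_term n i (obs \<omega>)) = 0"
  unfolding linear_term_alt by (rule expectation_combination)

text \<open>Source of the factor \<gamma>: the noise is summed over \<open>r n\<close> terms of size
  \<open>noise_var / r n\<close>, the trend over \<open>n\<close> terms of size
  \<open>r n / n\<^sup>2 * trend_var\<close>.\<close>

lemma sum_second_moment_linear_term:
  assumes "1 \<le> r n" "1 \<le> n"
  shows "(\<Sum>i=1..n. expectation (\<lambda>\<omega>. (linear_term n i (obs \<omega>))\<^sup>2))
    = noise_var + real (r n) / real n * trend_var"
proof -
  have "(\<Sum>i=1..n. expectation (\<lambda>\<omega>. (linear_term n i (obs \<omega>))\<^sup>2))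
      = (\<Sum>i=1..n. of_bool (i \<le> r n) * (noise_var / real (r n)) + real (r n) / (real n)\<^sup>2 * trend_var)"
    unfolding linear_term_alt second_moment_combination by (intro sum.cong) (auto simp: power_divide)
  also have "\<dots> = (\<Sum>i=1..n. of_bool (i \<le> r n) * (noise_var / real (r n))) + real (r n) / real n * trend_var"
    using assms by (simp add: sum.distrib power2_eq_square)
  also have "(\<Sum>i=1..n. of_bool (i \<le> r n) * (noise_var / real (r n))) = (\<Sum>i=1..r n. noise_var / real (r n))"
    using r_less[OF assms(2)] by (intro sum.mono_neutral_cong_right) auto
  also have "\<dots> = noise_var" using assms by simp
  finally show ?thesis .
qed

lemma linear_sum_CLT:
  "weak_conv_m (\<lambda>n. distr M borel (\<lambda>\<omega>. \<Sum>i=1..n. linear_term n i (Z i \<omega>)))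
     (distr std_normal_distribution borel (\<lambda>z. sqrt (noise_var + \<gamma> * trend_var) * z))"
proof (rule weak_conv_bounded_array[where B="\<lambda>n. (2 + \<bar>q\<bar>) / sqrt (real (r n))"])
  show "indep_vars (\<lambda>_. borel) (\<lambda>i \<omega>. linear_term n i (Z i \<omega>)) {1..n}" for n
    by (rule indep_comp_Z) auto
  show "expectation (\<lambda>\<omega>. linear_term n i (Z i \<omega>)) = 0" if "i \<in> {1..n}" for n i
    using expectation_Z[OF _ linear_term_borel] expectation_linear_term that by simp
  show "AE \<omega> in M. \<bar>linear_term n i (Z i \<omega>)\<bar> \<le> (2 + \<bar>q\<bar>) / sqrt (real (r n))" if "i \<in> {1..n}" for n i
  proof -
    have "1 \<le> i" "1 \<le> n" using that by auto
    from AE_Z[OF this(1)] show ?thesis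
      by eventually_elim (rule abs_linear_term_le[OF _ \<open>1 \<le> n\<close>])
  qed
  have "(\<lambda>n. noise_var + real (r n) / real n * trend_var) \<longlonglongrightarrow> noise_var + \<gamma> * trend_var"
    by (intro tendsto_intros r_ratio)
  moreover have "\<forall>\<^sub>F n in sequentially. noise_var + real (r n) / real n * trend_var
      = (\<Sum>i=1..n. expectation (\<lambda>\<omega>. (linear_term n i (Z i \<omega>))\<^sup>2))"
    using eventually_r_pos
  proof eventually_elim
    case (elim n)
    have "expectation (\<lambda>\<omega>. (linear_term n i (Z i \<omega>))\<^sup>2) = expectation (\<lambda>\<omega>. (linear_term n i (obs \<omega>))\<^sup>2)"
      if "i \<in> {1..n}" for i
      using that by (intro expectation_Z[of i "\<lambda>z. (linear_term n i z)\<^sup>2"]) auto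
    then show ?case using sum_second_moment_linear_term elim by simp
  qed
  ultimately show "(\<lambda>n. \<Sum>i=1..n. expectation (\<lambda>\<omega>. (linear_term n i (Z i \<omega>))\<^sup>2)) \<longlonglongrightarrow> noise_var + \<gamma> * trend_var"
    by (rule Lim_transform_eventually)
qed (auto simp: inverse_sqrt_r_tendsto noise_var_nonneg trend_var_nonneg \<gamma>_bounds)

lemma linear_sum_rv: "(\<lambda>\<omega>. \<Sum>i=1..n. linear_term n i (Z i \<omega>)) \<in> borel_measurable M"
  by (rule sum_Z_rv) auto

lemma q_hat_asymp_variance:
  "has_asymp_variance M (\<lambda>n. q_hat Xs Ys v b j (r n) n) q (\<lambda>n. real (r n)) (noise_var + \<gamma> * trend_var)"
  unfolding has_asymp_variance_def
  by (intro conjI weak_conv_asymp_equivalent[OF q_hat_linearization _ _ linear_sum_CLT real_distribution_scaled_std_normal])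
    (use linear_sum_rv in \<open>auto simp: noise_var_nonneg trend_var_nonneg \<gamma>_bounds\<close>)

text \<open>Almost surely label minus \<open>q\<close> is noise plus trend. Both are averaged over
  the labeled observations only, so \<open>trend_var\<close> keeps its full weight.\<close>

lemma Y_bar_asymp_variance:
  "has_asymp_variance M (\<lambda>n. Y_bar Ys j (r n)) q (\<lambda>n. real (r n)) (noise_var + trend_var)"
proof -
  let ?G = "\<lambda>n z. 1 / sqrt (real (r n)) * noise z + 1 / sqrt (real (r n)) * trend z"
  have G [measurable]: "?G n \<in> borel_measurable borel" for n by measurable
  have G_sum_rv: "(\<lambda>\<omega>. \<Sum>i=1..r n. ?G n (Z i \<omega>)) \<in> borel_measurable M" for n
    by (rule sum_Z_rv) auto
  have clt: "weak_conv_m (\<lambda>n. distr M borel (\<lambda>\<omega>. \<Sum>i=1..r n. ?G n (Z i \<omega>)))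
     (distr std_normal_distribution borel (\<lambda>z. sqrt (noise_var + trend_var) * z))"
  proof (rule weak_conv_bounded_array[where B="\<lambda>n. (2 + \<bar>q\<bar>) / sqrt (real (r n))"])
    show "indep_vars (\<lambda>_. borel) (\<lambda>i \<omega>. ?G n (Z i \<omega>)) {1..r n}" for n
      by (rule indep_comp_Z) auto
    show "expectation (\<lambda>\<omega>. ?G n (Z i \<omega>)) = 0" if "i \<in> {1..r n}" for n i
      using expectation_Z[OF _ G, of i n] that
        expectation_combination[of "1 / sqrt (real (r n))" "1 / sqrt (real (r n))"] by simp
    show "AE \<omega> in M. \<bar>?G n (Z i \<omega>)\<bar> \<le> (2 + \<bar>q\<bar>) / sqrt (real (r n))" if "i \<in> {1..r n}" for n i
    proof -
      have "1 \<le> i" using that by auto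
      from AE_Z[OF this] show ?thesis
      proof eventually_elim
        case (elim \<omega>)
        have "\<bar>?G n (Z i \<omega>)\<bar> = \<bar>noise (Z i \<omega>) + trend (Z i \<omega>)\<bar> / sqrt (real (r n))"
          by (simp add: add_divide_distrib[symmetric])
        also have "\<dots> \<le> (2 + \<bar>q\<bar>) / sqrt (real (r n))"
          using abs_noise_le[OF elim] abs_trend_le[OF elim] by (intro divide_right_mono) auto
        finally show ?case .
      qed
    qed
    have "\<forall>\<^sub>F n in sequentially. noise_var + trend_var = (\<Sum>i=1..r n. expectation (\<lambda>\<omega>. (?G n (Z i \<omega>))\<^sup>2))"
      using eventually_r_pos
    proof eventually_elim
      case (elim n)
      have "expectation (\<lambda>\<omega>. (?G n (Z i \<omega>))\<^sup>2) = noise_var / real (r n) + trend_var / real (r n)"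
        if "i \<in> {1..r n}" for i
      proof -
        have "expectation (\<lambda>\<omega>. (?G n (Z i \<omega>))\<^sup>2) = expectation (\<lambda>\<omega>. (?G n (obs \<omega>))\<^sup>2)"
          using that by (intro expectation_Z[of i "\<lambda>z. (?G n z)\<^sup>2"]) auto
        then show ?thesis unfolding second_moment_combination by (simp add: power_divide)
      qed
      then show ?case using elim by (simp add: field_simps)
    qed
    then show "(\<lambda>n. \<Sum>i=1..r n. expectation (\<lambda>\<omega>. (?G n (Z i \<omega>))\<^sup>2)) \<longlonglongrightarrow> noise_var + trend_var"
      by (rule Lim_transform_eventually[OF tendsto_const])
  qed (auto simp: inverse_sqrt_r_tendsto noise_var_nonneg trend_var_nonneg)
  have "asymp_equivalent M (\<lambda>n \<omega>. sqrt (real (r n)) * (Y_bar Ys j (r n) \<omega> - q)) (\<lambda>n \<omega>. \<Sum>i=1..r n. ?G n (Z i \<omega>))"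
  \<comment> \<open>The linearization is exact almost surely once \<open>r n\<close> is positive, so
    both comparisons are trivial and any \<open>\<delta>\<close> works.\<close>
  proof (rule asymp_equivalent_dominated[OF _ asymp_equivalent_refl[of M "\<lambda>_ _. 0"] asymp_equivalent_refl[of M "\<lambda>_ _. 0"]])
    fix \<epsilon> :: real assume "0 < \<epsilon>"
    have "\<forall>\<^sub>F n in sequentially. AE \<omega> in M. \<not>
      \<epsilon> \<le> \<bar>sqrt (real (r n)) * (Y_bar Ys j (r n) \<omega> - q) - (\<Sum>i=1..r n. ?G n (Z i \<omega>))\<bar>"
      using eventually_r_pos
    proof eventually_elim
      case (elim n)
      from AE_all_Z show ?case
      proof eventually_elim
        fix \<omega> assume adm: "\<forall>i\<ge>1. admissible (Z i \<omega>)"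
        have *: "Ys i \<omega> $ j - q = noise (Z i \<omega>) + trend (Z i \<omega>)" if i: "i \<in> {1..r n}" for i
        proof -
          have "admissible (Z i \<omega>)" using adm i by simp
          then obtain m where m: "m \<in> {1..b}" "\<And>k. k \<in> {1..b} \<Longrightarrow> cell k (Z i \<omega>) = of_bool (k = m)"
            using admissible_cell by blast
          show ?thesis
            using sum_weighted_cell[OF m, of "\<lambda>k. Ys i \<omega> $ j - d k"] sum_weighted_cell[OF m, of d]
            by (simp add: noise_def trend_def resid_def mult.commute)
        qed
        have "(\<Sum>i=1..r n. ?G n (Z i \<omega>)) = (\<Sum>i=1..r n. noise (Z i \<omega>) + trend (Z i \<omega>)) / sqrt (real (r n))"
          by (simp add: sum_divide_distrib add_divide_distrib)
        also have "(\<Sum>i=1..r n. noise (Z i \<omega>) + trend (Z i \<omega>)) = (\<Sum>i=1..r n. Ys i \<omega> $ j - q)"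
          using * by simp
        also have "\<dots> = real (r n) * (Y_bar Ys j (r n) \<omega> - q)"
          using elim by (simp add: Y_bar_def sum_subtractf field_simps)
        also have "\<dots> / sqrt (real (r n)) = sqrt (real (r n)) * (Y_bar Ys j (r n) \<omega> - q)"
          by (metis of_nat_0_le_iff real_div_sqrt times_divide_eq_left)
        finally show "\<not> \<epsilon> \<le> \<bar>sqrt (real (r n)) * (Y_bar Ys j (r n) \<omega> - q) - (\<Sum>i=1..r n. ?G n (Z i \<omega>))\<bar>"
          using \<open>0 < \<epsilon>\<close> by simp
      qed
    qed
    then show "\<exists>\<delta>>0. \<forall>\<^sub>F n in sequentially. AE \<omega> in M.
        \<epsilon> \<le> \<bar>sqrt (real (r n)) * (Y_bar Ys j (r n) \<omega> - q) - (\<Sum>i=1..r n. ?G n (Z i \<omega>))\<bar> \<longrightarrow>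
        \<delta> \<le> \<bar>(0::real) - 0\<bar> \<or> \<delta> \<le> \<bar>(0::real) - 0\<bar>"
      by (intro exI[of _ 1] conjI) (auto elim: eventually_mono)
  qed auto
  then show ?thesis
    unfolding has_asymp_variance_def
    by (intro conjI weak_conv_asymp_equivalent[OF _ _ _ clt real_distribution_scaled_std_normal])
      (use G_sum_rv in \<open>auto simp: noise_var_nonneg trend_var_nonneg\<close>)
qed

section \<open>Consistency\<close>

lemma q_hat_consistent: "asymp_equivalent M (\<lambda>n. q_hat Xs Ys v b j (r n) n) (\<lambda>_ _. q)"
proof (rule asymp_equivalent_dominated[OF _ q_hat_linearization])
  let ?L = "\<lambda>n \<omega>. \<Sum>i=1..n. linear_term n i (Z i \<omega>)"
  \<comment> \<open>The linear part has bounded second moments, so dividing it by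
    \<open>sqrt r\<close> sends it to 0 in probability.\<close>
  show "asymp_equivalent M (\<lambda>n \<omega>. ?L n \<omega> * (1 / sqrt (real (r n)))) (\<lambda>_ _. 0)"
  proof (rule asymp_equivalent_mult_bounded_second_moment)
    have "(\<lambda>n. (1 / sqrt (real (r n)))\<^sup>2) \<longlonglongrightarrow> 0\<^sup>2"
      by (intro tendsto_intros inverse_sqrt_r_tendsto)
    then show "asymp_equivalent M (\<lambda>n _. 1 / sqrt (real (r n))) (\<lambda>_ _. 0)"
      by (intro asymp_equivalent_second_moment) (auto simp: prob_space)
    have *: "integrable M (\<lambda>\<omega>. (?L n \<omega>)\<^sup>2) \<and> expectation (\<lambda>\<omega>. (?L n \<omega>)\<^sup>2) \<le> noise_var + trend_var" for n
    proof (cases "1 \<le> n \<and> 1 \<le> r n")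
      case True
      then have n: "1 \<le> n" and "1 \<le> r n" by auto
      note sm = second_moment_sum_Z[of "linear_term n", OF linear_term_borel abs_linear_term_le[OF _ n] expectation_linear_term, of n]
      have "real (r n) / real n * trend_var \<le> 1 * trend_var"
        using r_less[OF n] trend_var_nonneg by (intro mult_right_mono) (auto simp: divide_le_eq_1)
      then show ?thesis
        using sm sum_second_moment_linear_term[OF \<open>1 \<le> r n\<close> n] by simp
    next
      case False
      \<comment> \<open>Either the sum is empty, or \<open>r n = 0\<close> and both weights in
        \<open>linear_term\<close> vanish.\<close>
      then have L0: "?L n \<omega> = 0" for \<omega>
        by (auto simp: not_le linear_term_def intro!: sum.neutral)
      show ?thesis unfolding L0 using noise_var_nonneg trend_var_nonneg by simp
    qed
    show "integrable M (\<lambda>\<omega>. (?L n \<omega>)\<^sup>2)" for n using * by blast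
    show "expectation (\<lambda>\<omega>. (?L n \<omega>)\<^sup>2) \<le> noise_var + trend_var" for n using * by blast
  qed (use linear_sum_rv in auto)
  fix \<epsilon> :: real assume "0 < \<epsilon>"
  have "\<forall>\<^sub>F n in sequentially. AE \<omega> in M. \<epsilon> \<le> \<bar>q_hat Xs Ys v b j (r n) n \<omega> - q\<bar> \<longrightarrow>
      \<epsilon> / 2 \<le> \<bar>sqrt (real (r n)) * (q_hat Xs Ys v b j (r n) n \<omega> - q) - ?L n \<omega>\<bar> \<or>
      \<epsilon> / 2 \<le> \<bar>?L n \<omega> * (1 / sqrt (real (r n))) - 0\<bar>"
    using eventually_r_pos
  proof (eventually_elim, intro AE_I2 impI)
    fix n \<omega> assume n: "1 \<le> r n \<and> 1 \<le> n" and e: "\<epsilon> \<le> \<bar>q_hat Xs Ys v b j (r n) n \<omega> - q\<bar>"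
    define s x where "s = sqrt (real (r n))" and "x = q_hat Xs Ys v b j (r n) n \<omega> - q"
    have "1 \<le> s" using n by (simp add: s_def)
    then have "x = (s * x - ?L n \<omega>) / s + ?L n \<omega> * (1 / s)" by (simp add: field_simps)
    then have "\<bar>x\<bar> \<le> \<bar>(s * x - ?L n \<omega>) / s\<bar> + \<bar>?L n \<omega> * (1 / s)\<bar>"
      using abs_triangle_ineq[of "(s * x - ?L n \<omega>) / s" "?L n \<omega> * (1 / s)"] by (simp only:)
    also have "\<bar>(s * x - ?L n \<omega>) / s\<bar> \<le> \<bar>s * x - ?L n \<omega>\<bar>"
      using \<open>1 \<le> s\<close> by (simp add: divide_le_eq mult_le_cancel_left1)
    finally have "\<bar>x\<bar> \<le> \<bar>s * x - ?L n \<omega>\<bar> + \<bar>?L n \<omega> * (1 / s) - 0\<bar>" by simp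
    with e show "\<epsilon> / 2 \<le> \<bar>sqrt (real (r n)) * (q_hat Xs Ys v b j (r n) n \<omega> - q) - ?L n \<omega>\<bar> \<or>
      \<epsilon> / 2 \<le> \<bar>?L n \<omega> * (1 / sqrt (real (r n))) - 0\<bar>"
      unfolding s_def[symmetric] x_def[symmetric] by linarith
  qed
  with \<open>0 < \<epsilon>\<close> show "\<exists>\<delta>>0. \<forall>\<^sub>F n in sequentially. AE \<omega> in M. \<epsilon> \<le> \<bar>q_hat Xs Ys v b j (r n) n \<omega> - q\<bar> \<longrightarrow>
      \<delta> \<le> \<bar>sqrt (real (r n)) * (q_hat Xs Ys v b j (r n) n \<omega> - q) - ?L n \<omega>\<bar> \<or>
      \<delta> \<le> \<bar>?L n \<omega> * (1 / sqrt (real (r n))) - 0\<bar>"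
    by (intro exI[of _ "\<epsilon> / 2"]) simp
qed (use linear_sum_rv in auto)

text \<open>The total size \<open>m n\<close> is left free to cover both \<open>m n = n\<close> and
  \<open>m n = r n\<close>.\<close>

lemma sum_d_p_hat_consistent:
  assumes m: "filterlim m at_top sequentially" and rm: "\<And>n. 1 \<le> n \<Longrightarrow> r n \<le> m n"
  shows "asymp_equivalent M (\<lambda>n \<omega>. \<Sum>k=1..b. d k * p_hat Xs v (r n) (m n) k \<omega>) (\<lambda>_ _. q)"
proof (rule asymp_equivalent_dominated[OF _ _ asymp_equivalent_refl[of M "\<lambda>_ _. 0"]])
  have [measurable]: "(\<lambda>\<omega>. \<Sum>i=1..m n. trend (Z i \<omega>)) \<in> borel_measurable M" for n
    by (rule sum_Z_rv) auto
  show "asymp_equivalent M (\<lambda>n \<omega>. (\<Sum>i=1..m n. trend (Z i \<omega>)) / real (m n)) (\<lambda>_ _. 0)"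
    by (rule average_consistent[OF trend_borel abs_trend_le expectation_trend m])
  show "(\<lambda>\<omega>. (\<Sum>i=1..m n. trend (Z i \<omega>)) / real (m n)) \<in> borel_measurable M" for n
    by measurable
  fix \<epsilon> :: real assume "0 < \<epsilon>"
  have "\<forall>\<^sub>F n in sequentially. 1 \<le> m n" using m unfolding filterlim_at_top by blast
  then have "\<forall>\<^sub>F n in sequentially. AE \<omega> in M.
      \<epsilon> \<le> \<bar>(\<Sum>k=1..b. d k * p_hat Xs v (r n) (m n) k \<omega>) - q\<bar> \<longrightarrow>
      \<epsilon> \<le> \<bar>(\<Sum>i=1..m n. trend (Z i \<omega>)) / real (m n) - 0\<bar> \<or> \<epsilon> \<le> \<bar>(0::real) - 0\<bar>"
    using eventually_ge_at_top[of 1]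
  proof eventually_elim
    case (elim n)
    show ?case unfolding sum_d_p_hat[OF rm[OF elim(2)] elim(1)] by simp
  qed
  with \<open>0 < \<epsilon>\<close> show "\<exists>\<delta>>0. \<forall>\<^sub>F n in sequentially. AE \<omega> in M.
      \<epsilon> \<le> \<bar>(\<Sum>k=1..b. d k * p_hat Xs v (r n) (m n) k \<omega>) - q\<bar> \<longrightarrow>
      \<delta> \<le> \<bar>(\<Sum>i=1..m n. trend (Z i \<omega>)) / real (m n) - 0\<bar> \<or> \<delta> \<le> \<bar>(0::real) - 0\<bar>"
    by blast
qed auto

lemma q_hat_labeled_only_consistent:
  "asymp_equivalent M (\<lambda>n. q_hat Xs Ys v b j (r n) (r n)) (\<lambda>_ _. q)"
proof (rule asymp_equivalent_dominated[OF _ _ asymp_equivalent_refl[of M "\<lambda>_ _. 0"]])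
  have "asymp_equivalent M (\<lambda>n \<omega>. (\<Sum>i=1..r n. snd (Z i \<omega>) $ j) / real (r n)) (\<lambda>_ _. q)"
    by (rule average_consistent[where C=1, OF label_borel _ _ r_unbounded]) (auto simp: admissible_def)
  then show "asymp_equivalent M (\<lambda>n. Y_bar Ys j (r n)) (\<lambda>_ _. q)"
    by (simp add: asymp_equivalent_def Y_bar_def)
  fix \<epsilon> :: real assume "0 < \<epsilon>"
  moreover have "AE \<omega> in M. \<epsilon> \<le> \<bar>q_hat Xs Ys v b j (r n) (r n) \<omega> - q\<bar> \<longrightarrow>
      \<epsilon> \<le> \<bar>Y_bar Ys j (r n) \<omega> - q\<bar> \<or> \<epsilon> \<le> \<bar>(0::real) - 0\<bar>" for n
    using q_hat_labeled_only[of "r n"] by eventually_elim simp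
  ultimately show "\<exists>\<delta>>0. \<forall>\<^sub>F n in sequentially. AE \<omega> in M.
      \<epsilon> \<le> \<bar>q_hat Xs Ys v b j (r n) (r n) \<omega> - q\<bar> \<longrightarrow>
      \<delta> \<le> \<bar>Y_bar Ys j (r n) \<omega> - q\<bar> \<or> \<delta> \<le> \<bar>(0::real) - 0\<bar>"
    by (blast intro: always_eventually)
qed auto

end

theorem mainTheorem6:
  fixes M :: "'w measure"
    and X :: "'w \<Rightarrow> 'x::euclidean_space" and Y :: "'w \<Rightarrow> real ^ 'c"
    and Xs :: "nat \<Rightarrow> 'w \<Rightarrow> 'x" and Ys :: "nat \<Rightarrow> 'w \<Rightarrow> real ^ 'c"
    and v :: "nat \<Rightarrow> 'x" and b :: nat and j :: 'c
    and r :: "nat \<Rightarrow> nat" and \<gamma> :: real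
  defines "p \<equiv> val_prob M X v"
    and "d \<equiv> class_prob M X Y v j"
    and "q \<equiv> prob_space.expectation M (\<lambda>\<omega>. Y \<omega> $ j)"
  assumes prob: "prob_space M"
    and X_rv: "X \<in> borel_measurable M" and Y_rv: "Y \<in> borel_measurable M"
    and Y_01: "AE \<omega> in M. \<forall>l. Y \<omega> $ l \<in> {0, 1}"
    and v_inj: "inj_on v {1..b}"
    and X_discrete: "AE \<omega> in M. X \<omega> \<in> v ` {1..b}"
    and p_pos: "\<And>k. k \<in> {1..b} \<Longrightarrow> 0 < p k"
    and sample_indep: "prob_space.indep_vars M (\<lambda>_. borel) (\<lambda>i \<omega>. (Xs i \<omega>, Ys i \<omega>)) {1..}"
    and sample_law: "\<And>i. 1 \<le> i \<Longrightarrow>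
          distr M borel (\<lambda>\<omega>. (Xs i \<omega>, Ys i \<omega>)) = distr M borel (\<lambda>\<omega>. (X \<omega>, Y \<omega>))"
    and r_less: "\<And>n. 1 \<le> n \<Longrightarrow> r n < n"
    and r_ratio: "(\<lambda>n. real (r n) / real n) \<longlonglongrightarrow> \<gamma>"
    and r_unbounded: "filterlim r at_top sequentially"
    and labeled_extensive:
          "AE \<omega> in M. \<forall>\<^sub>F n in sequentially. \<forall>k\<in>{1..b}. \<exists>i\<in>{1..r n}. Xs i \<omega> = v k"
  shows
    "asymp_equivalent M (\<lambda>n. q_hat Xs Ys v b j (r n) n)
       (\<lambda>n \<omega>. \<Sum>k=1..b. d k * p_hat Xs v (r n) n k \<omega>)
     \<and> asymp_equivalent M (\<lambda>n. q_hat Xs Ys v b j (r n) (r n))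
       (\<lambda>n \<omega>. \<Sum>k=1..b. d k * p_hat Xs v (r n) (r n) k \<omega>)
     \<and> (\<forall>n\<ge>1.
       prob_space.variance M (\<lambda>\<omega>. \<Sum>k=1..b. d k * p_hat Xs v (r n) n k \<omega>) =
       1 / real n * ((\<Sum>k=1..b. (d k)\<^sup>2 * p k * (1 - p k))
         - 2 * (\<Sum>k=1..b. \<Sum>s=k+1..b. d k * d s * p k * p s)))
     \<and> (\<forall>n. 1 \<le> r n \<longrightarrow>
       prob_space.variance M (\<lambda>\<omega>. \<Sum>k=1..b. d k * p_hat Xs v (r n) (r n) k \<omega>) =
       1 / real (r n) * ((\<Sum>k=1..b. (d k)\<^sup>2 * p k * (1 - p k))
         - 2 * (\<Sum>k=1..b. \<Sum>s=k+1..b. d k * d s * p k * p s)))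
     \<and> (\<forall>n\<ge>1. 1 \<le> r n \<longrightarrow>
       prob_space.variance M (\<lambda>\<omega>. \<Sum>k=1..b. d k * p_hat Xs v (r n) n k \<omega>) \<le>
       prob_space.variance M (\<lambda>\<omega>. \<Sum>k=1..b. d k * p_hat Xs v (r n) (r n) k \<omega>))
     \<and> ((\<exists>k\<in>{1..b}. \<exists>s\<in>{1..b}. d k \<noteq> d s) \<longrightarrow> (\<forall>n\<ge>1. 1 \<le> r n \<longrightarrow>
       prob_space.variance M (\<lambda>\<omega>. \<Sum>k=1..b. d k * p_hat Xs v (r n) n k \<omega>) <
       prob_space.variance M (\<lambda>\<omega>. \<Sum>k=1..b. d k * p_hat Xs v (r n) (r n) k \<omega>)))
     \<and> (\<forall>n. AE \<omega> in M. q_hat Xs Ys v b j (r n) (r n) \<omega> = Y_bar Ys j (r n) \<omega>)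
     \<and> (\<exists>\<tau> \<sigma>. has_asymp_variance M (\<lambda>n. q_hat Xs Ys v b j (r n) n) q (\<lambda>n. real (r n)) \<tau>
       \<and> has_asymp_variance M (\<lambda>n. Y_bar Ys j (r n)) q (\<lambda>n. real (r n)) \<sigma>
       \<and> \<tau> \<le> \<sigma>
       \<and> (\<gamma> < 1 \<and> (\<exists>k\<in>{1..b}. \<exists>s\<in>{1..b}. d k \<noteq> d s) \<longrightarrow> \<tau> < \<sigma>))"
proof -
  interpret partially_labeled_sample M X Y Xs Ys v b j r \<gamma>
    using assms unfolding partially_labeled_sample_def partially_labeled_sample_axioms_def
      labeled_sample_def labeled_sample_axioms_def
    by auto
  have r_le: "\<And>n. 1 \<le> n \<Longrightarrow> r n \<le> n" using r_less by (auto intro: less_imp_le)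
  have sum_rv: "(\<lambda>\<omega>. \<Sum>k=1..b. d k * p_hat Xs v (r n) m k \<omega>) \<in> borel_measurable M" for n m
    unfolding d_def by measurable
  have var: "variance (\<lambda>\<omega>. \<Sum>k=1..b. d k * p_hat Xs v m n k \<omega>) = 1 / real n * trend_var"
    if "m \<le> n" "1 \<le> n" for m n
    using variance_sum_d_p_hat[OF that] by (simp only: d_def)
  have closed: "trend_var = (\<Sum>k=1..b. (d k)\<^sup>2 * p k * (1 - p k))
      - 2 * (\<Sum>k=1..b. \<Sum>s=k+1..b. d k * d s * p k * p s)"
    using trend_var_closed_form by (simp only: d_def p_def)
  have pos: "0 < trend_var" if "\<exists>k\<in>{1..b}. \<exists>s\<in>{1..b}. d k \<noteq> d s"
    using trend_var_pos that by (simp only: d_def)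
  have recip: "1 / real n \<le> 1 / real (r n)" "1 / real n < 1 / real (r n)" if "1 \<le> n" "1 \<le> r n" for n
    using r_less[OF that(1)] that by (simp_all add: frac_le frac_less2)
  show ?thesis
  proof (intro conjI allI impI exI)
    show "asymp_equivalent M (\<lambda>n. q_hat Xs Ys v b j (r n) n)
       (\<lambda>n \<omega>. \<Sum>k=1..b. d k * p_hat Xs v (r n) n k \<omega>)"
      using sum_d_p_hat_consistent[OF filterlim_ident r_le, folded d_def]
      by (intro asymp_equivalent_common_limit[OF q_hat_consistent]) (auto intro: sum_rv[simplified])
    show "asymp_equivalent M (\<lambda>n. q_hat Xs Ys v b j (r n) (r n))
       (\<lambda>n \<omega>. \<Sum>k=1..b. d k * p_hat Xs v (r n) (r n) k \<omega>)"
      using sum_d_p_hat_consistent[OF r_unbounded order_refl, folded d_def]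
      by (intro asymp_equivalent_common_limit[OF q_hat_labeled_only_consistent]) (auto intro: sum_rv[simplified])
    show "variance (\<lambda>\<omega>. \<Sum>k=1..b. d k * p_hat Xs v (r n) n k \<omega>) =
       1 / real n * ((\<Sum>k=1..b. (d k)\<^sup>2 * p k * (1 - p k))
         - 2 * (\<Sum>k=1..b. \<Sum>s=k+1..b. d k * d s * p k * p s))" if "1 \<le> n" for n
      using var[OF r_le[OF that] that] by (simp only: closed)
    show "variance (\<lambda>\<omega>. \<Sum>k=1..b. d k * p_hat Xs v (r n) (r n) k \<omega>) =
       1 / real (r n) * ((\<Sum>k=1..b. (d k)\<^sup>2 * p k * (1 - p k))
         - 2 * (\<Sum>k=1..b. \<Sum>s=k+1..b. d k * d s * p k * p s))" if "1 \<le> r n" for n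
      using var[OF order_refl that] by (simp only: closed)
    show "variance (\<lambda>\<omega>. \<Sum>k=1..b. d k * p_hat Xs v (r n) n k \<omega>)
        \<le> variance (\<lambda>\<omega>. \<Sum>k=1..b. d k * p_hat Xs v (r n) (r n) k \<omega>)" if "1 \<le> n" "1 \<le> r n" for n
      unfolding var[OF r_le[OF that(1)] that(1)] var[OF order_refl that(2)]
      by (rule mult_right_mono[OF recip(1)[OF that] trend_var_nonneg])
    show "variance (\<lambda>\<omega>. \<Sum>k=1..b. d k * p_hat Xs v (r n) n k \<omega>)
        < variance (\<lambda>\<omega>. \<Sum>k=1..b. d k * p_hat Xs v (r n) (r n) k \<omega>)"
      if "\<exists>k\<in>{1..b}. \<exists>s\<in>{1..b}. d k \<noteq> d s" "1 \<le> n" "1 \<le> r n" for n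
      unfolding var[OF r_le[OF that(2)] that(2)] var[OF order_refl that(3)]
      by (rule mult_strict_right_mono[OF recip(2)[OF that(2,3)] pos[OF that(1)]])
    show "AE \<omega> in M. q_hat Xs Ys v b j (r n) (r n) \<omega> = Y_bar Ys j (r n) \<omega>" for n
      by (rule q_hat_labeled_only)
    \<comment> \<open>The witnesses for \<open>\<tau>\<close> and \<open>\<sigma>\<close> share
      \<open>noise_var\<close>; only the weight of \<open>trend_var\<close> differs, being \<gamma>
      against 1.\<close>
    show "has_asymp_variance M (\<lambda>n. q_hat Xs Ys v b j (r n) n) q (\<lambda>n. real (r n)) (noise_var + \<gamma> * trend_var)"
      unfolding q_def by (rule q_hat_asymp_variance)
    show "has_asymp_variance M (\<lambda>n. Y_bar Ys j (r n)) q (\<lambda>n. real (r n)) (noise_var + trend_var)"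
      unfolding q_def by (rule Y_bar_asymp_variance)
    show "noise_var + \<gamma> * trend_var \<le> noise_var + trend_var"
      using mult_right_mono[OF \<gamma>_bounds(2) trend_var_nonneg] by simp
    show "noise_var + \<gamma> * trend_var < noise_var + trend_var"
      if "\<gamma> < 1 \<and> (\<exists>k\<in>{1..b}. \<exists>s\<in>{1..b}. d k \<noteq> d s)"
      using mult_strict_right_mono[of \<gamma> 1 trend_var] pos that by simp
  qed
qed

end
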